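(* Let $M\geq 1$. (i) For every finite ground set $E$, every weight function $w\colon E\to\mathbb{R}_{\geq0}$ and every monotone, $M$-bounded, fractionally subadditive objective $f\colon 2^{E}\to\mathbb{R}_{\geq0}$, there exists a $\rho$-competitive incremental solution with $\rho=\max\{3.293\sqrt{M},2M\}$. (ii) For every $\rho<\max\{2.449,M\}$ there exist a finite ground set $E$, weights $w\colon E\to\mathbb{R}_{\geq0}$ and a monotone, $M$-bounded, fractionally subadditive objective $f$ for which no incremental solution is $\rho$-competitive. In other words, the best possible $\rho$ for which the incremental knapsack problem admits $\rho$-competitive incremental solutions for all such instances lies in $[\max\{2.449,M\},\max\{3.293\sqrt{M},2M\}]$.
   Context: Incremental knapsack problem: $E$ is a finite ground set with $m=|E|$, $w\colon E\to\mathbb{R}_{\geq0}$ are weights, $w(S):=\sum_{e\in S}w(e)$, and $f\colon 2^{E}\to\mathbb{R}_{\geq0}$ is an objective. For a capacity $C>0$ let $f^{*}(C):=\max\{f(S): S\subseteq E,\ w(S)\leq C\}$. An incremental solution is an ordering $\pi=(e_{\pi(1)},\dots,e_{\pi(m)})$ of $E$; for $C>0$, $\pi(C):=\{e_{\pi(1)},\dots,e_{\pi(k)}\}$ where $k$ is the largest index with $\sum_{i=1}^{k}w(e_{\pi(i)})\leq C$ (the maximal prefix fitting into capacity $C$). For $\rho\geq1$, $\pi$ is $\rho$-competitive if $f^{*}(C)\leq\rho\cdot f(\pi(C))$ for all $C>0$. The objective $f$ is monotone if $f(A)\geq f(B)$ whenever $A\supseteq B$; $M$-bounded if $f(\{e\})\in[1,M]$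 for all $e\in E$; fractionally subadditive if $f(A)\leq\sum_{i=1}^{k}\alpha_{i}f(B_{i})$ for all $A,B_{1},\dots,B_{k}\subseteq E$ and all $\alpha_{1},\dots,\alpha_{k}\geq0$ with $\sum_{i:\,e\in B_{i}}\alpha_{i}\geq1$ for every $e\in A$. *)

theory Defs
  imports Complex_Main "HOL-Combinatorics.Multiset_Permutations"
begin

definition fractionally_subadditive :: "'a set \<Rightarrow> ('a set \<Rightarrow> real) \<Rightarrow> bool" where
  "fractionally_subadditive E f \<longleftrightarrow>
     (\<forall>A (k::nat) (B :: nat \<Rightarrow> 'a set) (\<alpha> :: nat \<Rightarrow> real).
        A \<subseteq> E \<longrightarrow> (\<forall>i<k. B i \<subseteq> E) \<longrightarrow> (\<forall>i<k. \<alpha> i \<ge> 0) \<longrightarrow>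
        (\<forall>e\<in>A. (\<Sum>i | i < k \<and> e \<in> B i. \<alpha> i) \<ge> 1) \<longrightarrow>
        f A \<le> (\<Sum>i<k. \<alpha> i * f (B i)))"

definition bounded_by :: "real \<Rightarrow> 'a set \<Rightarrow> ('a set \<Rightarrow> real) \<Rightarrow> bool" where
  "bounded_by M E f \<longleftrightarrow> (\<forall>e\<in>E. f {e} \<in> {1..M})"

definition knapsack_instance ::
    "real \<Rightarrow> 'a set \<Rightarrow> ('a \<Rightarrow> real) \<Rightarrow> ('a set \<Rightarrow> real) \<Rightarrow> bool" where
  "knapsack_instance M E w f \<longleftrightarrow>
     finite E \<and> (\<forall>e\<in>E. w e \<ge> 0) \<and> (\<forall>S\<subseteq>E. f S \<ge> 0) \<and>
     mono_on (Pow E) f \<and> bounded_by M E f \<and> fractionally_subadditive E f"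

definition opt_value ::
    "'a set \<Rightarrow> ('a \<Rightarrow> real) \<Rightarrow> ('a set \<Rightarrow> real) \<Rightarrow> real \<Rightarrow> real" where
  "opt_value E w f C = Max {f S | S. S \<subseteq> E \<and> sum w S \<le> C}"

definition fitting_prefix :: "('a \<Rightarrow> real) \<Rightarrow> 'a list \<Rightarrow> real \<Rightarrow> 'a set" where
  "fitting_prefix w \<pi> C =
     set (take (Max {k. k \<le> length \<pi> \<and> (\<Sum>i<k. w (\<pi> ! i)) \<le> C}) \<pi>)"

text \<open>An incremental solution is an ordering of \<open>E\<close>, i.e. an element of
  \<open>permutations_of_set E\<close>.\<close>

definition competitive ::
    "real \<Rightarrow> 'a set \<Rightarrow> ('a \<Rightarrow> real) \<Rightarrow> ('a set \<Rightarrow> real) \<Rightarrow> 'a list \<Rightarrow> bool" where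
  "competitive \<rho> E w f \<pi> \<longleftrightarrow>
     (\<forall>C>0. opt_value E w f C \<le> \<rho> * f (fitting_prefix w \<pi> C))"

text \<open>The best ratio attainable on all instances. Every finite ground set can be
  relabelled by natural numbers, so it suffices to range over subsets of \<^typ>\<open>nat\<close>.\<close>

definition best_competitive_ratio :: "real \<Rightarrow> real" where
  "best_competitive_ratio M =
     Inf {\<rho>. \<rho> \<ge> 1 \<and>
            (\<forall>(E :: nat set) w f. knapsack_instance M E w f \<longrightarrow>
               (\<exists>\<pi>\<in>permutations_of_set E. competitive \<rho> E w f \<pi>))}"

end

theory Submission
  imports Defs "HOL-Library.Indicator_Function"
begin

text \<open>Upper bound. The order is built in phases with capacities \<open>C\<^sub>1 < C\<^sub>2 < \<dots>\<close>, where \<open>C\<^sub>1\<close> is the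
  least weight and phase \<open>i\<close> appends an optimal set of capacity \<open>C\<^sub>i\<close>. The next capacity is the first
  one where the optimal value exceeds \<open>\<rho>\<close> times the current one, but at least 3 times the
  current capacity (5/2 times in phase 2). By LP duality a fractionally subadditive function has an
  additive minorant that is exact on a given set; sorting an optimal set by density with respect to
  it makes the value of its prefixes proportional to their weight, up to an error of \<open>M\<close>. This gives
  both the value of a partially added set and the growth bound \<open>opt D \<le> D / C * (opt C + M)\<close>. The
  values of phases 3 and later exceed \<open>\<rho>\<^sup>2\<close>, so that the error \<open>M\<close> is small compared to them; the
  first two phases need only that removing one element costs at most \<open>M\<close>.\<close>

section \<open>Farkas' lemma\<close>

text \<open>A pair \<open>(a, b)\<close> encodes the inequality \<open>(\<Sum>x\<in>X. a x * v x) \<le> b\<close> in the unknown \<open>v\<close>.\<close>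

inductive_set conic_hull :: "(('a \<Rightarrow> real) \<times> real) set \<Rightarrow> (('a \<Rightarrow> real) \<times> real) set"
  for I where
  base: "p \<in> I \<Longrightarrow> p \<in> conic_hull I"
| add: "(a, b) \<in> conic_hull I \<Longrightarrow> (a', b') \<in> conic_hull I \<Longrightarrow>
    (\<lambda>x. a x + a' x, b + b') \<in> conic_hull I"
| scale: "(a, b) \<in> conic_hull I \<Longrightarrow> c > 0 \<Longrightarrow> (\<lambda>x. c * a x, c * b) \<in> conic_hull I"

lemma conic_hull_subset:
  assumes "J \<subseteq> conic_hull I"
  shows "conic_hull J \<subseteq> conic_hull I"
proof
  fix p assume "p \<in> conic_hull J"
  then show "p \<in> conic_hull I"
    by induction (use assms in \<open>auto intro: conic_hull.intros\<close>)
qed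

lemma conic_hull_coefficient_zero:
  assumes "p \<in> conic_hull I" "\<And>p. p \<in> I \<Longrightarrow> fst p x = 0"
  shows "fst p x = 0"
  using assms(1) by induction (use assms(2) in auto)

text \<open>This chooses the eliminated unknown between its lower and upper bounds. Either side may
  be empty, and \<open>Min\<close> and \<open>Max\<close> say nothing about an empty set, hence the
  cases.\<close>

lemma exists_between_finite:
  fixes L U :: "real set"
  assumes "finite L" "finite U" "\<And>l u. l \<in> L \<Longrightarrow> u \<in> U \<Longrightarrow> l \<le> u"
  shows "\<exists>t. (\<forall>l\<in>L. l \<le> t) \<and> (\<forall>u\<in>U. t \<le> u)"
proof (cases "L = {}")
  case True
  show ?thesis
  proof (cases "U = {}")
    case False
    with True assms show ?thesis by (intro exI[of _ "Min U"]) auto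
  qed (use True in auto)
next
  case False
  with assms show ?thesis by (intro exI[of _ "Max L"]) auto
qed

text \<open>Fourier--Motzkin elimination of one unknown at a time.\<close>

theorem farkas:
  assumes "finite X" "finite I"
  shows "(\<exists>v. \<forall>(a, b)\<in>I. (\<Sum>x\<in>X. a x * v x) \<le> b) \<or>
    (\<exists>(a, b)\<in>conic_hull I. (\<forall>x\<in>X. a x = 0) \<and> b < 0)"
  using assms
proof (induction X arbitrary: I rule: finite_induct)
  case empty
  show ?case
  proof (cases "\<exists>(a, b)\<in>I. b < 0")
    case True
    then show ?thesis by (auto intro: conic_hull.base)
  next
    case False
    then show ?thesis by (intro disjI1) force
  qed
next
  case (insert x X)
  define P where "P = {p\<in>I. fst p x > 0}"
  define N where "N = {p\<in>I. fst p x < 0}"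
  \<comment> \<open>Both multipliers are positive and cancel the coefficient of \<open>x\<close>, so
    the combination stays in the conic hull of \<open>I\<close> and no longer involves
    \<open>x\<close>.\<close>
  define comb :: "(('a \<Rightarrow> real) \<times> real) \<times> ('a \<Rightarrow> real) \<times> real \<Rightarrow> ('a \<Rightarrow> real) \<times> real"
    where "comb = (\<lambda>(p, q). (\<lambda>y. (- fst q x) * fst p y + fst p x * fst q y,
      (- fst q x) * snd p + fst p x * snd q))"
  define J where "J = {p\<in>I. fst p x = 0} \<union> comb ` (P \<times> N)"
  have fin: "finite P" "finite N" "finite J"
    using insert.prems by (auto simp: P_def N_def J_def)
  have zero: "fst p x = 0" if "p \<in> J" for p
    using that by (auto simp: J_def comb_def)
  have "J \<subseteq> conic_hull I"
  proof
    fix r assume "r \<in> J"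
    then consider "r \<in> I" | p q where "p \<in> P" "q \<in> N" "r = comb (p, q)"
      unfolding J_def by auto
    then show "r \<in> conic_hull I"
    proof cases
      case 1
      then show ?thesis by (rule conic_hull.base)
    next
      case 2
      have "(fst p, snd p) \<in> conic_hull I" "(fst q, snd q) \<in> conic_hull I"
        "- fst q x > 0" "fst p x > 0"
        using 2 by (auto simp: P_def N_def intro: conic_hull.base)
      then show ?thesis
        unfolding 2(3) comb_def prod.case
        by (intro conic_hull.add conic_hull.scale)
    qed
  qed
  then have hull: "conic_hull J \<subseteq> conic_hull I" by (rule conic_hull_subset)
  show ?case
  proof (cases "\<exists>(a, b)\<in>conic_hull J. (\<forall>x\<in>X. a x = 0) \<and> b < 0")
    case True
    then obtain a b where ab: "(a, b) \<in> conic_hull J" "\<forall>x\<in>X. a x = 0" "b < 0" by auto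
    have "a x = 0" using conic_hull_coefficient_zero[OF ab(1) zero] by simp
    with ab hull show ?thesis by (intro disjI2 bexI[of _ "(a, b)"]) auto
  next
    case False
    then obtain v where v: "\<And>p. p \<in> J \<Longrightarrow> (\<Sum>y\<in>X. fst p y * v y) \<le> snd p"
      using insert.IH[OF fin(3)] by (auto simp: case_prod_beta)
    define g where "g p = (snd p - (\<Sum>y\<in>X. fst p y * v y)) / fst p x" for p
    have "\<exists>t. (\<forall>l\<in>g ` N. l \<le> t) \<and> (\<forall>u\<in>g ` P. t \<le> u)"
    proof (rule exists_between_finite)
      fix l u assume "l \<in> g ` N" "u \<in> g ` P"
      then obtain p q where pq: "p \<in> P" "q \<in> N" "l = g q" "u = g p" by auto
      have pos: "fst p x > 0" "fst q x < 0" using pq by (auto simp: P_def N_def)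
      have "comb (p, q) \<in> J" using pq by (auto simp: J_def)
      from v[OF this] have "(- fst q x) * (\<Sum>y\<in>X. fst p y * v y) + fst p x * (\<Sum>y\<in>X. fst q y * v y)
          \<le> (- fst q x) * snd p + fst p x * snd q"
        by (simp add: comb_def sum_distrib_left sum_subtractf algebra_simps sum.distrib sum_negf)
      then show "l \<le> u" using pos unfolding pq g_def
        by (simp add: divide_simps) (simp add: algebra_simps)
    qed (use fin in auto)
    then obtain t where t: "\<And>q. q \<in> N \<Longrightarrow> g q \<le> t" "\<And>p. p \<in> P \<Longrightarrow> t \<le> g p" by auto
    have "(\<Sum>y\<in>insert x X. fst p y * (v(x := t)) y) \<le> snd p" if p: "p \<in> I" for p
    proof -
      have "(\<Sum>y\<in>X. fst p y * (v(x := t)) y) = (\<Sum>y\<in>X. fst p y * v y)"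
        using insert.hyps by (intro sum.cong) auto
      then have eq: "(\<Sum>y\<in>insert x X. fst p y * (v(x := t)) y) = fst p x * t + (\<Sum>y\<in>X. fst p y * v y)"
        using insert.hyps by simp
      consider "fst p x = 0" | "p \<in> P" | "p \<in> N"
        using p by (cases "fst p x" "0 :: real" rule: linorder_cases) (auto simp: P_def N_def)
      then show ?thesis
      proof cases
        case 1
        then show ?thesis unfolding eq using v[of p] p by (simp add: J_def)
      next
        case 2
        then have "fst p x > 0" by (simp add: P_def)
        with t(2)[OF 2] show ?thesis unfolding eq g_def by (simp add: field_simps)
      next
        case 3
        then have "fst p x < 0" by (simp add: N_def)
        with t(1)[OF 3] show ?thesis unfolding eq g_def by (simp add: field_simps)
      qed
    qed
    then show ?thesis by (intro disjI1 exI[of _ "v(x := t)"]) (auto simp: case_prod_beta)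
  qed
qed

section \<open>Additive minorants\<close>

text \<open>The easy direction of duality: a minorant that reaches \<open>f A\<close> on
  \<open>A\<close> is summed over the cover, and exchanging the sums compares it with the values
  \<open>f (B i)\<close>. The lower-bound instances are verified this way.\<close>

lemma fractionally_subadditiveI:
  assumes "finite E"
    and supp: "\<And>A. A \<subseteq> E \<Longrightarrow> \<exists>v. (\<forall>e\<in>E. v e \<ge> 0) \<and> f A \<le> sum v A \<and> (\<forall>B\<subseteq>E. sum v B \<le> f B)"
  shows "fractionally_subadditive E f"
  unfolding fractionally_subadditive_def
proof (intro allI impI)
  fix A k and B :: "nat \<Rightarrow> 'a set" and \<alpha> :: "nat \<Rightarrow> real"
  assume A: "A \<subseteq> E" and B: "\<forall>i<k. B i \<subseteq> E" and \<alpha>: "\<forall>i<k. \<alpha> i \<ge> 0"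
    and cover: "\<forall>e\<in>A. (\<Sum>i | i < k \<and> e \<in> B i. \<alpha> i) \<ge> 1"
  obtain v where v: "\<forall>e\<in>E. v e \<ge> 0" "f A \<le> sum v A" "\<forall>B\<subseteq>E. sum v B \<le> f B"
    using supp[OF A] by auto
  have fin: "finite A" using A \<open>finite E\<close> by (rule finite_subset)
  have "f A \<le> (\<Sum>e\<in>A. (\<Sum>i | i < k \<and> e \<in> B i. \<alpha> i) * v e)"
  proof (rule order.trans[OF v(2)], rule sum_mono)
    fix e assume "e \<in> A"
    then show "v e \<le> (\<Sum>i | i < k \<and> e \<in> B i. \<alpha> i) * v e"
      using mult_right_mono[of 1 "\<Sum>i | i < k \<and> e \<in> B i. \<alpha> i" "v e"] v(1) A cover by auto
  qed
  also have "\<dots> \<le> (\<Sum>e\<in>E. (\<Sum>i | i < k \<and> e \<in> B i. \<alpha> i) * v e)"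
    using v A \<alpha> \<open>finite E\<close> by (intro sum_mono2 mult_nonneg_nonneg sum_nonneg) auto
  also have "\<dots> = (\<Sum>e\<in>E. \<Sum>i<k. if e \<in> B i then \<alpha> i * v e else 0)"
    by (intro sum.cong refl)
      (simp add: sum_distrib_right sum.If_cases Int_def conj_commute)
  also have "\<dots> = (\<Sum>i<k. \<Sum>e\<in>E. if e \<in> B i then \<alpha> i * v e else 0)"
    by (rule sum.swap)
  also have "\<dots> = (\<Sum>i<k. \<alpha> i * sum v (B i))"
  proof (intro sum.cong refl)
    fix i assume "i \<in> {..<k}"
    then have "E \<inter> B i = B i" using B by auto
    then show "(\<Sum>e\<in>E. if e \<in> B i then \<alpha> i * v e else 0) = \<alpha> i * sum v (B i)"
      using \<open>finite E\<close> by (simp add: sum.inter_restrict[symmetric] sum_distrib_left)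
  qed
  also have "\<dots> \<le> (\<Sum>i<k. \<alpha> i * f (B i))"
    using v B \<alpha> by (intro sum_mono mult_left_mono) auto
  finally show "f A \<le> (\<Sum>i<k. \<alpha> i * f (B i))" .
qed

text \<open>Covers are defined with numbered members, whereas the certificate from
  \<open>farkas\<close> is indexed by the subsets themselves; an enumeration of the family
  translates.\<close>

lemma fractionally_subadditive_sumD:
  assumes "fractionally_subadditive E f" "finite \<F>" "A \<subseteq> E"
    and "\<And>B. B \<in> \<F> \<Longrightarrow> B \<subseteq> E" "\<And>B. B \<in> \<F> \<Longrightarrow> \<alpha> B \<ge> 0"
    and cover: "\<And>e. e \<in> A \<Longrightarrow> (\<Sum>B | B \<in> \<F> \<and> e \<in> B. \<alpha> B) \<ge> 1"
  shows "f A \<le> (\<Sum>B\<in>\<F>. \<alpha> B * f B)"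
proof -
  obtain h where h: "bij_betw h {0..<card \<F>} \<F>"
    using ex_bij_betw_nat_finite[OF \<open>finite \<F>\<close>] by blast
  then have h': "bij_betw h {..<card \<F>} \<F>" by (simp add: lessThan_atLeast0)
  have mem: "h i \<in> \<F>" if "i < card \<F>" for i using h' that by (auto simp: bij_betw_def)
  have sub: "(\<Sum>i | i < card \<F> \<and> e \<in> h i. \<alpha> (h i)) = (\<Sum>B | B \<in> \<F> \<and> e \<in> B. \<alpha> B)" for e
  proof (rule sum.reindex_bij_betw)
    show "bij_betw h {i. i < card \<F> \<and> e \<in> h i} {B. B \<in> \<F> \<and> e \<in> B}"
      using h' by (rule bij_betw_subset) (use h' in \<open>auto simp: bij_betw_def\<close>)
  qed
  have "f A \<le> (\<Sum>i<card \<F>. \<alpha> (h i) * f (h i))"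
    using assms(1)[unfolded fractionally_subadditive_def, rule_format, of A "card \<F>" h "\<alpha> \<circ> h"]
      assms(3-5) mem cover by (simp add: sub)
  also have "\<dots> = (\<Sum>B\<in>\<F>. \<alpha> B * f B)" by (rule sum.reindex_bij_betw[OF h'])
  finally show ?thesis .
qed

text \<open>The hard direction. If no \<open>v\<close> exists, \<open>farkas\<close> combines the
  inequalities \<open>sum v A \<le> f A\<close> and \<open>- sum v S \<le> - f S\<close> into a
  contradiction, which after scaling is a fractional cover of \<open>S\<close> cheaper than
  \<open>f S\<close>. Nothing forces \<open>v\<close> to be nonnegative; \<open>greedy_order\<close>
  truncates it.\<close>

lemma fractionally_subadditive_minorant:
  fixes E :: "'a set"
  assumes fs: "fractionally_subadditive E f" and fin: "finite S" and "S \<subseteq> E"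
    and nonneg: "\<And>A. A \<subseteq> S \<Longrightarrow> f A \<ge> 0"
  shows "\<exists>v :: 'a \<Rightarrow> real. f S \<le> sum v S \<and> (\<forall>A\<subseteq>S. sum v A \<le> f A)"
proof -
  define I where "I = insert (\<lambda>x. - indicator S x, - f S)
    ((\<lambda>A. (indicator A :: 'a \<Rightarrow> real, f A)) ` Pow S)"
  have "finite I" using fin by (auto simp: I_def)
  \<comment> \<open>\<open>\<alpha> A\<close> is the multiplier of the upper bound on
    \<open>A\<close>, and \<open>\<beta>\<close> that of the lower bound on
    \<open>S\<close>.\<close>
  have hull: "\<exists>\<alpha> \<beta>. (\<forall>A\<in>Pow S. \<alpha> A \<ge> 0) \<and> \<beta> \<ge> 0 \<and>
      (\<forall>x. fst p x = (\<Sum>A\<in>Pow S. \<alpha> A * indicator A x) - \<beta> * indicator S x) \<and>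
      snd p = (\<Sum>A\<in>Pow S. \<alpha> A * f A) - \<beta> * f S" if "p \<in> conic_hull I" for p
    using that
  proof induction
    case (base p)
    then consider "p = (\<lambda>x. - indicator S x, - f S)" | A where "A \<subseteq> S" "p = (indicator A, f A)"
      by (auto simp: I_def)
    then show ?case
    proof cases
      case 1
      then show ?thesis by (intro exI[of _ "\<lambda>_. 0"] exI[of _ 1]) auto
    next
      case 2
      then show ?thesis using fin
        by (intro exI[of _ "\<lambda>B. if B = A then 1 else 0"] exI[of _ 0])
          (auto simp: if_distribR if_distrib[of "\<lambda>c. c * _"] sum.delta cong: if_cong)
    qed
  next
    case (add a b a' b')
    then obtain \<alpha> \<beta> \<alpha>' \<beta>' where *: "\<forall>A\<in>Pow S. \<alpha> A \<ge> 0" "\<beta> \<ge> 0"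
        "\<forall>x. a x = (\<Sum>A\<in>Pow S. \<alpha> A * indicator A x) - \<beta> * indicator S x"
        "b = (\<Sum>A\<in>Pow S. \<alpha> A * f A) - \<beta> * f S"
        "\<forall>A\<in>Pow S. \<alpha>' A \<ge> 0" "\<beta>' \<ge> 0"
        "\<forall>x. a' x = (\<Sum>A\<in>Pow S. \<alpha>' A * indicator A x) - \<beta>' * indicator S x"
        "b' = (\<Sum>A\<in>Pow S. \<alpha>' A * f A) - \<beta>' * f S"
      by auto
    show ?case
      by (intro exI[of _ "\<lambda>A. \<alpha> A + \<alpha>' A"] exI[of _ "\<beta> + \<beta>'"])
        (use * in \<open>auto simp: sum.distrib distrib_right\<close>)
  next
    case (scale a b c)
    then obtain \<alpha> \<beta> where *: "\<forall>A\<in>Pow S. \<alpha> A \<ge> 0" "\<beta> \<ge> 0"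
        "\<forall>x. a x = (\<Sum>A\<in>Pow S. \<alpha> A * indicator A x) - \<beta> * indicator S x"
        "b = (\<Sum>A\<in>Pow S. \<alpha> A * f A) - \<beta> * f S"
      by auto
    show ?case
      by (intro exI[of _ "\<lambda>A. c * \<alpha> A"] exI[of _ "c * \<beta>"])
        (use * \<open>c > 0\<close> in \<open>auto simp: sum_distrib_left right_diff_distrib mult.assoc\<close>)
  qed
  have "\<not> (\<exists>(a, b)\<in>conic_hull I. (\<forall>x\<in>S. a x = 0) \<and> b < 0)"
  proof
    assume "\<exists>(a, b)\<in>conic_hull I. (\<forall>x\<in>S. a x = 0) \<and> b < 0"
    then obtain p where p: "p \<in> conic_hull I" "\<forall>x\<in>S. fst p x = 0" "snd p < 0" by auto
    obtain \<alpha> \<beta> where \<alpha>: "\<And>A. A \<subseteq> S \<Longrightarrow> \<alpha> A \<ge> 0" and \<beta>: "\<beta> \<ge> 0"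
      and fst: "\<And>x. fst p x = (\<Sum>A\<in>Pow S. \<alpha> A * indicator A x) - \<beta> * indicator S x"
      and snd: "snd p = (\<Sum>A\<in>Pow S. \<alpha> A * f A) - \<beta> * f S"
      using hull[OF p(1)] by auto
    have eq: "(\<Sum>A\<in>Pow S. \<alpha> A * indicator A x) = \<beta>" if "x \<in> S" for x
      using p(2) fst[of x] that by (auto simp: indicator_def)
    have lt: "(\<Sum>A\<in>Pow S. \<alpha> A * f A) < \<beta> * f S" using p(3) snd by simp
    moreover have "(\<Sum>A\<in>Pow S. \<alpha> A * f A) \<ge> 0"
      using \<alpha> nonneg by (intro sum_nonneg mult_nonneg_nonneg) auto
    \<comment> \<open>With \<open>\<beta> = 0\<close> the combined right-hand side would be a
      nonnegative sum, not a negative number. Dividing by \<open>\<beta>\<close> then turns the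
      multipliers into a cover.\<close>
    ultimately have "\<beta> > 0" using \<beta> by (cases "\<beta> = 0") auto
    have "f S \<le> (\<Sum>A\<in>Pow S. (\<alpha> A / \<beta>) * f A)"
    proof (rule fractionally_subadditive_sumD[OF fs])
      fix x assume x: "x \<in> S"
      have "(\<Sum>A | A \<in> Pow S \<and> x \<in> A. \<alpha> A / \<beta>) = (\<Sum>A\<in>Pow S. \<alpha> A * indicator A x) / \<beta>"
        unfolding sum_divide_distrib using fin
        by (intro sum.mono_neutral_cong_left) (auto simp: indicator_def)
      then show "1 \<le> (\<Sum>A | A \<in> Pow S \<and> x \<in> A. \<alpha> A / \<beta>)"
        using eq[OF x] \<open>\<beta> > 0\<close> by simp
    qed (use fin \<open>S \<subseteq> E\<close> \<alpha> \<beta> in auto)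
    also have "\<dots> = (\<Sum>A\<in>Pow S. \<alpha> A * f A) / \<beta>" by (simp add: sum_divide_distrib)
    finally show False using lt \<open>\<beta> > 0\<close> by (simp add: field_simps)
  qed
  with farkas[OF fin \<open>finite I\<close>] obtain v
    where v: "\<And>p. p \<in> I \<Longrightarrow> (\<Sum>x\<in>S. fst p x * v x) \<le> snd p"
    by (auto simp: case_prod_beta)
  have "f S \<le> sum v S"
    using v[of "(\<lambda>x. - indicator S x, - f S)"] by (simp add: I_def sum_negf)
  moreover have "sum v A \<le> f A" if "A \<subseteq> S" for A
  proof -
    have "sum v A = (\<Sum>x\<in>S. indicator A x * v x)"
      using that fin by (intro sum.mono_neutral_cong_left) (auto simp: indicator_def)
    then show ?thesis using v[of "(indicator A, f A)"] that by (simp add: I_def)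
  qed
  ultimately show ?thesis by blast
qed

section \<open>Greedy orders\<close>

text \<open>The last element is chosen with least density \<open>v e / w e\<close>; all inequalities are
  cross-multiplied, so that zero weights need no special treatment.\<close>

lemma density_order:
  fixes v w :: "'a \<Rightarrow> real"
  assumes "finite S" "\<And>e. e \<in> S \<Longrightarrow> w e \<ge> 0" "\<And>e. e \<in> S \<Longrightarrow> v e \<ge> 0"
  shows "\<exists>L. distinct L \<and> set L = S \<and>
    (\<forall>k. sum w (set (take k L)) * sum v S \<le> sum v (set (take k L)) * sum w S)"
  using assms
proof (induction "card S" arbitrary: S)
  case 0
  then show ?case by (intro exI[of _ "[]"]) auto
next
  case (Suc n)
  then have "S \<noteq> {}" by auto
  \<comment> \<open>Averaging: if every element were denser than \<open>S\<close> as a whole,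
    summing over \<open>S\<close> would make \<open>sum w S * sum v S\<close> less than
    itself.\<close>
  have "\<exists>e\<in>S. v e * sum w S \<le> w e * sum v S"
  proof (rule ccontr)
    assume "\<not> ?thesis"
    then have "(\<Sum>e\<in>S. w e * sum v S) < (\<Sum>e\<in>S. v e * sum w S)"
      using \<open>S \<noteq> {}\<close> Suc.prems(1) by (intro sum_strict_mono) auto
    then show False by (simp add: sum_distrib_right[symmetric] mult.commute)
  qed
  then obtain e where e: "e \<in> S" "v e * sum w S \<le> w e * sum v S" by auto
  define T where "T = S - {e}"
  have T: "finite T" "T \<subseteq> S" "card T = n" "S = insert e T" "e \<notin> T"
    using e(1) Suc by (auto simp: T_def)
  obtain L where L: "distinct L" "set L = T"
    "\<And>k. sum w (set (take k L)) * sum v T \<le> sum v (set (take k L)) * sum w T"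
    using Suc.hyps(1)[of T] T Suc.prems by blast
  have sums: "sum v S = v e + sum v T" "sum w S = w e + sum w T"
    using T by simp_all
  \<comment> \<open>Removing an element of at most average density cannot lower the average, so
    prefix bounds relative to \<open>T\<close> carry over to \<open>S\<close>.\<close>
  have T_dens: "sum w T * sum v S \<le> sum v T * sum w S"
    using e(2) unfolding sums by (simp add: algebra_simps)
  have nonneg: "sum w A \<ge> 0" "sum v A \<ge> 0" if "A \<subseteq> S" for A
    using that Suc.prems by (auto intro!: sum_nonneg)
  have prefix: "sum w A * sum v S \<le> sum v A * sum w S"
    if A: "A \<subseteq> T" and le: "sum w A * sum v T \<le> sum v A * sum w T" for A
  \<comment> \<open>A weightless \<open>T\<close> permits no cancellation, but then \<open>A\<close>
    is weightless too and the left side vanishes.\<close>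
  proof (cases "sum w T = 0")
    case True
    have "sum w A \<le> sum w T"
      using A T Suc.prems by (intro sum_mono2) auto
    then have "sum w A = 0" using True nonneg(1)[of A] A T(2) by fastforce
    then show ?thesis using nonneg A T(2) by auto
  next
    case False
    then have pos: "sum w T > 0" using nonneg(1)[OF T(2)] by simp
    have "sum w T * (sum w A * sum v S) \<le> sum w A * (sum v T * sum w S)"
      using mult_left_mono[OF T_dens nonneg(1)[of A]] A T(2) by (simp add: ac_simps)
    also have "\<dots> \<le> sum w T * (sum v A * sum w S)"
      using mult_right_mono[OF le nonneg(1)[of S]] by (simp add: ac_simps)
    finally show ?thesis using pos by simp
  qed
  have "sum w (set (take k (L @ [e]))) * sum v S \<le> sum v (set (take k (L @ [e]))) * sum w S" for k
  proof (cases "k \<le> length L")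
    case True
    then show ?thesis using prefix[OF _ L(3)] L(2) set_take_subset[of k L] by simp
  next
    case False
    then have "set (take k (L @ [e])) = S" using L(2) T(4) by auto
    then show ?thesis by (simp add: mult.commute)
  qed
  then show ?case using L T by (intro exI[of _ "L @ [e]"]) auto
qed

text \<open>The sets of different phases may overlap. A repeated element leaves the set of a prefix
  unchanged, so dropping repetitions loses no prefix set.\<close>

lemma first_occurrences:
  "\<exists>\<pi>. distinct \<pi> \<and> set \<pi> = set L \<and> (\<forall>k. \<exists>k'. set (take k' \<pi>) = set (take k L))"
proof (induction L rule: rev_induct)
  case (snoc x L)
  then obtain \<pi> where \<pi>: "distinct \<pi>" "set \<pi> = set L"
    "\<And>k. \<exists>k'. set (take k' \<pi>) = set (take k L)" by auto
  define \<pi>' where "\<pi>' = (if x \<in> set L then \<pi> else \<pi> @ [x])"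
  have "set \<pi>' = set (L @ [x])" using \<pi> by (auto simp: \<pi>'_def)
  moreover have "\<exists>k'. set (take k' \<pi>') = set (take k (L @ [x]))" for k
  proof (cases "k \<le> length L")
    case True
    obtain k' where k': "set (take k' \<pi>) = set (take k L)" using \<pi>(3) by blast
    \<comment> \<open>\<open>min\<close> is needed because \<open>k'\<close> may exceed
      \<open>length \<pi>\<close> and would then reach the new element \<open>x\<close>.\<close>
    have "take (min k' (length \<pi>)) \<pi>' = take k' \<pi>"
      by (auto simp: \<pi>'_def min_def)
    then show ?thesis using True k' by (intro exI[of _ "min k' (length \<pi>)"]) simp
  next
    case False
    then show ?thesis using \<open>set \<pi>' = _\<close> by (intro exI[of _ "length \<pi>'"]) simp
  qed
  ultimately show ?case using \<pi>(1,2) by (intro exI[of _ \<pi>']) (auto simp: \<pi>'_def)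
qed auto

section \<open>The knapsack problem\<close>

lemma opt_value_ge:
  assumes "finite E" "S \<subseteq> E" "sum w S \<le> C"
  shows "f S \<le> opt_value E w f C"
proof -
  have "{f S |S. S \<subseteq> E \<and> sum w S \<le> C} \<subseteq> f ` Pow E" by auto
  then have "finite {f S |S. S \<subseteq> E \<and> sum w S \<le> C}"
    by (rule finite_subset) (use assms(1) in auto)
  then show ?thesis unfolding opt_value_def using assms by (intro Max_ge) auto
qed

lemma opt_value_attained:
  assumes "finite E" "C \<ge> 0"
  obtains S where "S \<subseteq> E" "sum w S \<le> C" "f S = opt_value E w f C"
proof -
  let ?V = "{f S |S. S \<subseteq> E \<and> sum w S \<le> C}"
  have "?V \<subseteq> f ` Pow E" by auto
  then have "finite ?V" by (rule finite_subset) (use assms(1) in auto)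
  moreover have "f {} \<in> ?V" using assms(2) by (intro CollectI exI[of _ "{}"]) auto
  ultimately have "opt_value E w f C \<in> ?V"
    unfolding opt_value_def by (intro Max_in) auto
  then show ?thesis using that by auto
qed

text \<open>Trades the maximal index for the largest prefix set. \<open>\<pi>\<close> is distinct,
  so indexed sums are sums over sets; \<open>C \<ge> 0\<close> lets the empty prefix fit, so the
  maximum exists.\<close>

lemma fitting_prefix_eq:
  assumes "\<pi> \<in> permutations_of_set E" "C \<ge> 0"
  obtains k where "k \<le> length \<pi>" "fitting_prefix w \<pi> C = set (take k \<pi>)"
    "sum w (set (take k \<pi>)) \<le> C" "\<And>k'. sum w (set (take k' \<pi>)) \<le> C \<Longrightarrow> set (take k' \<pi>) \<subseteq> set (take k \<pi>)"
proof -
  have dist: "distinct \<pi>" using assms(1) by (simp add: permutations_of_set_def)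
  have sum_eq: "(\<Sum>i<k. w (\<pi> ! i)) = sum w (set (take k \<pi>))" if "k \<le> length \<pi>" for k
    using that dist
    by (simp add: sum.distinct_set_conv_list sum_list_sum_nth atLeast0LessThan flip: map_map)
  let ?K = "{k. k \<le> length \<pi> \<and> (\<Sum>i<k. w (\<pi> ! i)) \<le> C}"
  have fin: "finite ?K" by simp
  have "Max ?K \<in> ?K" using assms(2) by (intro Max_in) (auto intro: exI[of _ 0])
  moreover have "set (take k' \<pi>) \<subseteq> set (take (Max ?K) \<pi>)"
    if le: "sum w (set (take k' \<pi>)) \<le> C" for k'
  proof -
    have eq: "take (min k' (length \<pi>)) \<pi> = take k' \<pi>" by (simp add: min_def)
    then have "min k' (length \<pi>) \<in> ?K" using le sum_eq[of "min k' (length \<pi>)"] by auto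
    then have "min k' (length \<pi>) \<le> Max ?K" using fin by (intro Max_ge) auto
    then show ?thesis using set_take_subset_set_take[of "min k' (length \<pi>)" "Max ?K" \<pi>] eq by simp
  qed
  ultimately show ?thesis
    using that[of "Max ?K"] sum_eq unfolding fitting_prefix_def by auto
qed

locale knapsack =
  fixes M :: real and E :: "'a set" and w :: "'a \<Rightarrow> real" and f :: "'a set \<Rightarrow> real"
  assumes inst: "knapsack_instance M E w f"
begin

abbreviation opt :: "real \<Rightarrow> real" where
  "opt \<equiv> opt_value E w f"

lemma finite_ground: "finite E"
  and weight_nonneg: "e \<in> E \<Longrightarrow> w e \<ge> 0"
  and value_nonneg: "S \<subseteq> E \<Longrightarrow> f S \<ge> 0"
  and value_mono: "A \<subseteq> B \<Longrightarrow> B \<subseteq> E \<Longrightarrow> f A \<le> f B"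
  and singleton_ge: "e \<in> E \<Longrightarrow> f {e} \<ge> 1"
  and singleton_le: "e \<in> E \<Longrightarrow> f {e} \<le> M"
  and frac_subadd: "fractionally_subadditive E f"
  using inst by (auto simp: knapsack_instance_def bounded_by_def mono_on_def)

lemma finite_sub: "S \<subseteq> E \<Longrightarrow> finite S"
  using finite_ground by (rule rev_finite_subset)

lemma sum_weight_nonneg: "S \<subseteq> E \<Longrightarrow> sum w S \<ge> 0"
  using weight_nonneg by (auto intro!: sum_nonneg)

lemma sum_weight_mono: "A \<subseteq> B \<Longrightarrow> B \<subseteq> E \<Longrightarrow> sum w A \<le> sum w B"
  using weight_nonneg finite_sub by (intro sum_mono2) auto

lemma value_empty: "f {} = 0"
  using frac_subadd[unfolded fractionally_subadditive_def, rule_format, of "{}" 0] value_nonneg[of "{}"]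
  by simp

lemma value_insert_le:
  assumes "S \<subseteq> E" "e \<in> E"
  shows "f (insert e S) \<le> f S + M"
proof -
  have "f (insert e S) \<le> (\<Sum>B\<in>{S, {e}}. 1 * f B)"
  proof (rule fractionally_subadditive_sumD[OF frac_subadd])
    fix x assume "x \<in> insert e S"
    then have "{B. B \<in> {S, {e}} \<and> x \<in> B} \<noteq> {}" by auto
    moreover have fin: "finite {B. B \<in> {S, {e}} \<and> x \<in> B}" by simp
    ultimately have "1 \<le> card {B. B \<in> {S, {e}} \<and> x \<in> B}"
      by (metis One_nat_def Suc_leI card_gt_0_iff)
    then show "1 \<le> (\<Sum>B | B \<in> {S, {e}} \<and> x \<in> B. 1 :: real)"
      by (simp flip: real_of_card)
  qed (use assms in auto)
  \<comment> \<open>The family is a set and collapses to one member if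
    \<open>S = {e}\<close>.\<close>
  also have "\<dots> \<le> f S + f {e}"
    using value_nonneg assms by (cases "S = {e}") auto
  finally show ?thesis using singleton_le[OF assms(2)] by simp
qed

lemma value_remove_le: "S \<subseteq> E \<Longrightarrow> e \<in> S \<Longrightarrow> f S \<le> f (S - {e}) + M"
  using value_insert_le[of "S - {e}" e] by (metis Diff_subset insert_Diff subset_iff)

lemma value_le_card: "S \<subseteq> E \<Longrightarrow> f S \<le> card S * M"
proof (induction "card S" arbitrary: S)
  case 0
  then show ?case using finite_sub value_empty by simp
next
  case (Suc n)
  then obtain e T where "S = insert e T" "e \<notin> T" "card T = n"
    by (metis card_Suc_eq)
  then have "f T \<le> n * M" "card S = Suc n" "f S \<le> f T + M"
    using Suc value_insert_le[of T e] by auto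
  then show ?case by (simp add: algebra_simps)
qed

lemma sum_le_sum_list: "set L \<subseteq> E \<Longrightarrow> sum w (set L) \<le> sum_list (map w L)"
proof (induction L)
  case (Cons a L)
  then show ?case using weight_nonneg[of a] by (cases "a \<in> set L") (auto simp: insert_absorb)
qed simp

lemma opt_ge: "S \<subseteq> E \<Longrightarrow> sum w S \<le> C \<Longrightarrow> f S \<le> opt C"
  by (rule opt_value_ge[OF finite_ground])

lemma opt_nonneg: "C \<ge> 0 \<Longrightarrow> opt C \<ge> 0"
  using opt_ge[of "{}" C] by (simp add: value_empty)

lemma opt_le:
  assumes "C \<ge> 0" "\<And>S. S \<subseteq> E \<Longrightarrow> sum w S \<le> C \<Longrightarrow> f S \<le> B"
  shows "opt C \<le> B"
  using opt_value_attained[OF finite_ground assms(1)] assms(2) by metis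

text \<open>Sorted by density with respect to an additive minorant, a prefix collects its proportional
  share of the value, up to the one element that no longer fits.\<close>

lemma greedy_order:
  assumes "S \<subseteq> E" "M \<ge> 0"
  obtains L where "distinct L" "set L = S"
    "\<And>c C. 0 \<le> c \<Longrightarrow> c \<le> C \<Longrightarrow> 0 < C \<Longrightarrow> sum w S \<le> C \<Longrightarrow>
      \<exists>k. sum w (set (take k L)) \<le> c \<and> c / C * f S - M \<le> f (set (take k L))"
proof -
  obtain u where u: "f S \<le> sum u S" "\<And>A. A \<subseteq> S \<Longrightarrow> sum u A \<le> f A"
    using fractionally_subadditive_minorant[OF frac_subadd finite_sub[OF assms(1)] assms(1)]
      value_nonneg assms(1) by (metis subset_trans)
  \<comment> \<open>Truncation at 0 keeps a minorant: \<open>sum v A\<close> is the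
    \<open>u\<close>-sum over the elements of \<open>A\<close> with positive \<open>u\<close>, and
    \<open>f\<close> is monotone.\<close>
  define v where "v e = max 0 (u e)" for e
  have minor: "sum v A \<le> f A" if "A \<subseteq> S" for A
  proof -
    have "sum v A = sum u {e\<in>A. u e > 0}"
      using finite_sub[of A] that assms(1) by (intro sum.mono_neutral_cong_right) (auto simp: v_def)
    also have "\<dots> \<le> f {e\<in>A. u e > 0}" using that by (intro u(2)) auto
    also have "\<dots> \<le> f A" using that assms(1) by (intro value_mono) auto
    finally show ?thesis .
  qed
  have "f S \<le> sum v S" using u(1) by (rule order.trans) (auto intro: sum_mono simp: v_def)
  with minor[of S] have total: "sum v S = f S" by simp
  have v_le: "v e \<le> M" if "e \<in> S" for e
    using minor[of "{e}"] singleton_le[of e] that assms(1) by auto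
  have "\<exists>L. distinct L \<and> set L = S \<and>
      (\<forall>k. sum w (set (take k L)) * sum v S \<le> sum v (set (take k L)) * sum w S)"
    using weight_nonneg assms(1) by (intro density_order finite_sub) (auto simp: v_def)
  then obtain L where L: "distinct L" "set L = S"
    and dens: "\<And>k. sum w (set (take k L)) * f S \<le> sum v (set (take k L)) * sum w S"
    unfolding total by auto
  have "\<exists>k. sum w (set (take k L)) \<le> c \<and> c / C * f S - M \<le> f (set (take k L))"
    if c: "0 \<le> c" "c \<le> C" "0 < C" "sum w S \<le> C" for c C
  proof -
    let ?K = "{k. k \<le> length L \<and> sum w (set (take k L)) \<le> c}"
    \<comment> \<open>The longest prefix of weight at most \<open>c\<close>. One more element
      exceeds \<open>c\<close>, so the extended prefix has the full share
      \<open>c / C * f S\<close>, of which the extra element accounts for at most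
      \<open>M\<close>.\<close>
    define k where "k = Max ?K"
    have "finite ?K" by simp
    moreover have "0 \<in> ?K" using c by simp
    ultimately have k: "k \<in> ?K" and max: "\<And>j. j \<in> ?K \<Longrightarrow> j \<le> k"
      unfolding k_def using Max_in Max_ge by (blast, blast)
    have "c / C * f S - M \<le> f (set (take k L))"
    proof (cases "k = length L")
      case True
      have "c / C * f S \<le> 1 * f S"
        using c value_nonneg[OF assms(1)] by (intro mult_right_mono) auto
      then show ?thesis using True L assms(2) by simp
    next
      case False
      then have "k < length L" using k by simp
      define P where "P = set (take k L)"
      have PS: "P \<subseteq> S" using set_take_subset[of k L] L(2) by (simp add: P_def)
      have next_in: "L ! k \<in> S" using \<open>k < length L\<close> L(2) by auto
      have ins: "set (take (Suc k) L) = insert (L ! k) P"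
        using \<open>k < length L\<close> by (simp add: P_def take_Suc_conv_app_nth)
      have new: "L ! k \<notin> P"
        using L(1) \<open>k < length L\<close> by (auto simp: P_def in_set_conv_nth nth_eq_iff_index_eq)
      have "Suc k \<notin> ?K" using max[of "Suc k"] by auto
      then have gt: "c < sum w (insert (L ! k) P)"
        using \<open>k < length L\<close> ins by auto
      also have "\<dots> \<le> sum w S" using PS next_in assms(1) by (intro sum_weight_mono) auto
      finally have wS: "sum w S > 0" using c by simp
      have "c / C * f S \<le> c / sum w S * f S"
        using c wS value_nonneg[OF assms(1)] by (intro mult_right_mono divide_left_mono) auto
      also have "\<dots> \<le> sum w (insert (L ! k) P) / sum w S * f S"
        using gt wS value_nonneg[OF assms(1)] by (intro mult_right_mono divide_right_mono) auto
      also have "\<dots> \<le> sum v (insert (L ! k) P)"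
        using dens[of "Suc k"] wS by (simp add: ins field_simps)
      also have "\<dots> = v (L ! k) + sum v P"
        using new finite_sub[of P] PS assms(1) by simp
      also have "\<dots> \<le> M + f P"
        using v_le[OF next_in] minor[OF PS] by simp
      finally show ?thesis by (simp add: P_def)
    qed
    then show ?thesis using k by auto
  qed
  with L show ?thesis by (rule that)
qed

text \<open>A greedy prefix of a set feasible for \<open>D\<close> fits into \<open>C\<close>, hence
  is worth at most \<open>opt C\<close>, and it holds a share \<open>C / D\<close> of the value up
  to \<open>M\<close>.\<close>

lemma opt_growth:
  assumes "0 < C" "C \<le> D" "M \<ge> 0"
  shows "opt D \<le> D / C * (opt C + M)"
proof (rule opt_le)
  fix S assume S: "S \<subseteq> E" "sum w S \<le> D"
  obtain L where L: "set L = S"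
    "\<And>c C. 0 \<le> c \<Longrightarrow> c \<le> C \<Longrightarrow> 0 < C \<Longrightarrow> sum w S \<le> C \<Longrightarrow>
      \<exists>k. sum w (set (take k L)) \<le> c \<and> c / C * f S - M \<le> f (set (take k L))"
    using greedy_order[OF S(1) assms(3)] by metis
  obtain k where k: "sum w (set (take k L)) \<le> C" "C / D * f S - M \<le> f (set (take k L))"
    using L(2)[of C D] assms S by auto
  have "f (set (take k L)) \<le> opt C"
    using k(1) L(1) S(1) set_take_subset[of k L] by (intro opt_ge) auto
  with k(2) have "C / D * f S \<le> opt C + M" by simp
  then show "f S \<le> D / C * (opt C + M)" using assms by (simp add: field_simps)
qed (use assms in auto)

definition serves :: "real \<Rightarrow> 'a list \<Rightarrow> real \<Rightarrow> bool" where
  "serves \<rho> L C \<longleftrightarrow>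
    (\<exists>k. sum_list (map w (take k L)) \<le> C \<and> opt C \<le> \<rho> * f (set (take k L)))"

lemma serves_append: "serves \<rho> L C \<Longrightarrow> serves \<rho> (L @ L') C"
proof -
  assume "serves \<rho> L C"
  then obtain k where k: "sum_list (map w (take k L)) \<le> C" "opt C \<le> \<rho> * f (set (take k L))"
    by (auto simp: serves_def)
  have "take (min k (length L)) (L @ L') = take k L" by (simp add: min_def)
  with k show ?thesis unfolding serves_def by (intro exI[of _ "min k (length L)"]) simp
qed

lemma serves_whole:
  assumes "sum_list (map w L) \<le> C" "S \<subseteq> set L" "set L \<subseteq> E" "\<rho> \<ge> 0" "opt C \<le> \<rho> * f S"
  shows "serves \<rho> L C"
proof -
  have "\<rho> * f S \<le> \<rho> * f (set L)"
    using assms by (intro mult_left_mono value_mono)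
  then show ?thesis using assms unfolding serves_def by (intro exI[of _ "length L"]) simp
qed

text \<open>The list in question may contain repetitions; keeping only first occurrences frees capacity.\<close>

lemma competitive_of_serves:
  assumes "set L = E" "\<rho> \<ge> 0" "\<And>C. C > 0 \<Longrightarrow> serves \<rho> L C"
  shows "\<exists>\<pi>\<in>permutations_of_set E. competitive \<rho> E w f \<pi>"
proof -
  obtain \<pi> where \<pi>: "distinct \<pi>" "set \<pi> = E" "\<And>k. \<exists>k'. set (take k' \<pi>) = set (take k L)"
    using first_occurrences[of L] assms(1) by auto
  have perm: "\<pi> \<in> permutations_of_set E" using \<pi> by (simp add: permutations_of_set_def)
  have "opt C \<le> \<rho> * f (fitting_prefix w \<pi> C)" if C: "C > 0" for C
  proof -
    obtain k where k: "sum_list (map w (take k L)) \<le> C" "opt C \<le> \<rho> * f (set (take k L))"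
      using assms(3)[OF C] by (auto simp: serves_def)
    obtain k' where k': "set (take k' \<pi>) = set (take k L)" using \<pi>(3) by blast
    obtain j where j: "fitting_prefix w \<pi> C = set (take j \<pi>)"
      "\<And>k'. sum w (set (take k' \<pi>)) \<le> C \<Longrightarrow> set (take k' \<pi>) \<subseteq> set (take j \<pi>)"
      using fitting_prefix_eq[OF perm, of C] C by (metis less_imp_le)
    have sub: "set (take k L) \<subseteq> E" using assms(1) set_take_subset[of k L] by simp
    then have "set (take k L) \<subseteq> set (take j \<pi>)"
      using j(2)[of k'] k' k(1) sum_le_sum_list[OF sub] by simp
    then have "\<rho> * f (set (take k L)) \<le> \<rho> * f (fitting_prefix w \<pi> C)"
      using j(1) \<pi>(2) set_take_subset[of j \<pi>] assms(2) by (intro mult_left_mono value_mono) auto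
    with k(2) show ?thesis by simp
  qed
  then show ?thesis using perm by (auto simp: competitive_def)
qed

end

section \<open>Phase construction for a ratio \<open>\<rho>\<close>\<close>

locale knapsack_ratio = knapsack +
  fixes \<rho> :: real
  assumes M_ge: "M \<ge> 1" and rho_ge: "\<rho> \<ge> 3.293" and rho_M: "2 * M \<le> \<rho>"
    and rho_sq: "10.84 * M \<le> \<rho>\<^sup>2"
begin

text \<open>A lightest set of value above \<open>B\<close> decides: the maximum of \<open>D\<close>
  and its weight is the first capacity from \<open>D\<close> on where \<open>opt\<close> exceeds
  \<open>B\<close>. The other alternative ends the construction.\<close>

lemma next_capacity:
  "(\<forall>S\<subseteq>E. f S \<le> B) \<or>
    (\<exists>C\<ge>D. B < opt C \<and> (\<forall>C'. 0 \<le> C' \<longrightarrow> D \<le> C' \<longrightarrow> C' < C \<longrightarrow> opt C' \<le> B))"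
proof (cases "\<forall>S\<subseteq>E. f S \<le> B")
  case False
  let ?\<A> = "{S. S \<subseteq> E \<and> B < f S}"
  have "finite ?\<A>" "?\<A> \<noteq> {}" using False finite_ground by (auto simp: not_le)
  then obtain A where A: "A \<in> ?\<A>" "\<And>S. S \<in> ?\<A> \<Longrightarrow> sum w A \<le> sum w S"
    using ex_is_arg_min_if_finite[of ?\<A> "sum w"] by (auto simp: is_arg_min_linorder)
  have "B < opt (max D (sum w A))"
    using A(1) opt_ge[of A "max D (sum w A)"] by auto
  moreover have "opt C' \<le> B" if "0 \<le> C'" "D \<le> C'" "C' < max D (sum w A)" for C'
  proof (rule opt_le)
    fix S assume "S \<subseteq> E" "sum w S \<le> C'"
    then show "f S \<le> B" using A(2)[of S] that by force
  qed (use that in auto)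
  ultimately show ?thesis by (intro disjI2 exI[of _ "max D (sum w A)"]) auto
qed simp

text \<open>After the last phase, \<open>S\<close> is within the factor \<open>\<rho>\<close> of
  every set, so the remaining elements may follow in any order.\<close>

lemma finish:
  assumes "set L \<subseteq> E" "S \<subseteq> set L" "\<And>A. A \<subseteq> E \<Longrightarrow> f A \<le> \<rho> * f S"
    and "\<And>C. 0 < C \<Longrightarrow> C < sum_list (map w L) \<Longrightarrow> serves \<rho> L C"
  shows "\<exists>L'. set L' = E \<and> (\<forall>C>0. serves \<rho> L' C)"
proof -
  obtain X where X: "set X = E" using finite_ground finite_list by blast
  have "serves \<rho> L C" if "C > 0" for C
  proof (cases "C < sum_list (map w L)")
    case False
    have "opt C \<le> \<rho> * f S" using that assms(3) by (intro opt_le) auto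
    then show ?thesis using False assms(1,2) rho_ge by (intro serves_whole) auto
  qed (use assms(4) that in auto)
  then have "\<forall>C>0. serves \<rho> (L @ X) C" by (blast intro: serves_append)
  moreover have "set (L @ X) = E" using X assms(1) by auto
  ultimately show ?thesis by blast
qed

text \<open>\<open>F\<close> is the optimal value at the capacity of the current phase; \<open>x\<close> is the capacity to be served
  and \<open>q\<close> the weight added in earlier phases, both relative to the capacity of the phase.\<close>

lemma greedy_phase_arith:
  assumes "F \<ge> \<rho>\<^sup>2" "q \<le> 8 / 15" "x \<ge> 1"
  shows "x * (F + M) \<le> \<rho> * ((x - q) * F - M)"
proof -
  have F: "F \<ge> 0" using assms(1) by (smt (verit) zero_le_power2)
  have "(1 + \<rho>) * M \<le> (1 + \<rho>) * (\<rho>\<^sup>2 / 10.84)"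
    using rho_sq rho_ge by (intro mult_left_mono) auto
  \<comment> \<open>\<open>7 / 15\<close> is what the bound on \<open>q\<close> leaves; the
    comparison of the two factors of \<open>\<rho>\<^sup>2\<close> holds from
    \<open>\<rho> = 3.293\<close> on.\<close>
  also have "\<dots> \<le> (7 / 15 * \<rho> - 1) * \<rho>\<^sup>2"
    using rho_ge mult_right_mono[of "(1 + \<rho>) / 10.84" "7 / 15 * \<rho> - 1" "\<rho>\<^sup>2"] by simp
  also have "\<dots> \<le> (7 / 15 * \<rho> - 1) * F"
    using assms(1) rho_ge by (intro mult_left_mono) auto
  finally have base: "(1 + \<rho>) * M \<le> (7 / 15 * \<rho> - 1) * F" .
  have q: "\<rho> * (q * F) \<le> \<rho> * (8 / 15 * F)"
    using assms(2) F rho_ge by (intro mult_left_mono mult_right_mono) auto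
  have "\<rho> * F \<ge> 0" "\<rho> * M \<ge> 0" using F M_ge rho_ge by simp_all
  \<comment> \<open>The claim is affine in \<open>x\<close> with slope
    \<open>\<rho> * F - F - M \<ge> 0\<close>, so \<open>x = 1\<close> is the critical case.\<close>
  with base have "\<rho> * F - F - M \<ge> 0" by (simp add: algebra_simps)
  then have "(\<rho> * F - F - M) \<le> x * (\<rho> * F - F - M)"
    using assms(3) mult_right_mono[of 1 x] by simp
  with base q show ?thesis by (simp add: algebra_simps)
qed

text \<open>With \<open>opt_growth\<close>, a phase set of value \<open>F\<close> suffices up to
  three times its capacity: the slack \<open>\<rho> - 3 \<ge> 0.293\<close> absorbs
  \<open>3 * M\<close>, because \<open>F \<ge> 10.84 * M\<close>.\<close>

lemma triple_capacity_arith: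
  assumes "F \<ge> \<rho>\<^sup>2"
  shows "3 * (F + M) \<le> \<rho> * F"
proof -
  have "3 * M \<le> 3 / 10.84 * \<rho>\<^sup>2" using rho_sq by simp
  also have "\<dots> \<le> (\<rho> - 3) * \<rho>\<^sup>2" using rho_ge by (intro mult_right_mono) auto
  also have "\<dots> \<le> (\<rho> - 3) * F" using rho_ge assms by (intro mult_left_mono) auto
  finally show ?thesis by (simp add: algebra_simps)
qed

text \<open>The analogue for phase 2. Only \<open>F \<ge> \<rho>\<close> is known there, so
  \<open>M\<close> can be a larger share of \<open>F\<close> and the factor 3 drops to 5/2.\<close>

lemma second_capacity_arith:
  assumes "F \<ge> \<rho>"
  shows "5 / 2 * (F + M) \<le> \<rho> * F"
proof -
  have "5 / 2 * M \<le> (5 / 2 / 10.84 * \<rho>) * \<rho>" using rho_sq by (simp add: power2_eq_square)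
  also have "\<dots> \<le> (\<rho> - 5 / 2) * \<rho>" using rho_ge by (intro mult_right_mono) auto
  also have "\<dots> \<le> (\<rho> - 5 / 2) * F" using rho_ge assms by (intro mult_left_mono) auto
  finally show ?thesis by (simp add: algebra_simps)
qed

text \<open>\<open>F\<close> is the value of phase 1. The left side bounds the optimum while phase 2
  is being packed; the right side is \<open>\<rho>\<close> times a lower bound for the second set
  without one element.\<close>

lemma second_phase_arith:
  assumes "F \<ge> 1"
  shows "\<rho> * F + M \<le> \<rho> * (\<rho> * F - M)"
proof -
  have "2 * (\<rho> * M) \<le> \<rho> * \<rho>" using mult_left_mono[OF rho_M, of \<rho>] rho_ge by simp
  moreover have "10 * M \<le> \<rho> * \<rho>" using rho_sq M_ge by (simp add: power2_eq_square)
  moreover have "3 * \<rho> \<le> \<rho> * \<rho>" using rho_ge by (intro mult_right_mono) auto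
  moreover have "(\<rho> - 1) * \<rho> = \<rho> * \<rho> - \<rho>" by (simp add: left_diff_distrib)
  ultimately have *: "\<rho> * M + M \<le> (\<rho> - 1) * \<rho>" using rho_ge M_ge by linarith
  also have "\<dots> \<le> (\<rho> - 1) * \<rho> * F"
    using assms rho_ge mult_left_mono[of 1 F "(\<rho> - 1) * \<rho>"] by simp
  finally show ?thesis by (simp add: algebra_simps)
qed

text \<open>Induction on a bound \<open>n\<close> for \<open>f E - opt C\<close>: each phase raises
  the optimum by at least 1. The constant \<open>8 / 15\<close> is
  \<open>(1 + 1 / 3) * (2 / 5)\<close>, from the first two capacity jumps; later phases preserve it,
  as \<open>(1 + 8 / 15) / 3 < 8 / 15\<close>.\<close>

lemma late_phases:
  assumes "set L \<subseteq> E" "sum_list (map w L) \<le> 8 / 15 * C" "C > 0" "opt C \<ge> \<rho>\<^sup>2"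
    and "\<And>C'. 0 < C' \<Longrightarrow> C' < C \<Longrightarrow> serves \<rho> L C'" and "f E \<le> opt C + real n"
  shows "\<exists>L'. set L' = E \<and> (\<forall>C>0. serves \<rho> L' C)"
  using assms
proof (induction n arbitrary: L C rule: less_induct)
  case (less n)
  obtain S where S: "S \<subseteq> E" "sum w S \<le> C" "f S = opt C"
    using opt_value_attained[OF finite_ground, of C] less.prems(3) by (metis less_imp_le)
  obtain G where G: "distinct G" "set G = S"
    "\<And>c. 0 \<le> c \<Longrightarrow> c \<le> C \<Longrightarrow>
      \<exists>k. sum w (set (take k G)) \<le> c \<and> c / C * f S - M \<le> f (set (take k G))"
    using greedy_order[of S] S(1,2) M_ge less.prems(3) by (metis order.trans zero_le_one)
  define W where "W = sum_list (map w L)"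
  have W: "0 \<le> W" "W \<le> 8 / 15 * C"
    using less.prems(1,2) weight_nonneg by (auto simp: W_def subset_iff intro!: sum_list_nonneg)
  have LG: "set (L @ G) \<subseteq> E" using less.prems(1) G(2) S(1) by auto
  have "sum_list (map w G) = sum w S"
    using G(1,2) by (metis sum.distinct_set_conv_list)
  then have wLG: "sum_list (map w (L @ G)) \<le> W + C" using S(2) by (simp add: W_def)
  \<comment> \<open>From capacity \<open>C\<close> on, \<open>L\<close> is packed completely and
    \<open>C' - W\<close> remains for a prefix of the greedy list \<open>G\<close>.\<close>
  have below: "serves \<rho> (L @ G) C'" if C': "0 < C'" "C' < W + C" for C'
  proof (cases "C' < C")
    case True
    then show ?thesis using less.prems(5) C' by (intro serves_append) auto
  next
    case False
    obtain k where k: "sum w (set (take k G)) \<le> C' - W"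
        "(C' - W) / C * f S - M \<le> f (set (take k G))"
      using G(3)[of "C' - W"] C' False W less.prems(3) by auto
    have "opt C' \<le> C' / C * (opt C + M)"
      using False less.prems(3) M_ge by (intro opt_growth) auto
    also have "\<dots> \<le> \<rho> * ((C' / C - W / C) * opt C - M)"
      using W False less.prems(3,4) by (intro greedy_phase_arith) (auto simp: field_simps)
    also have "\<dots> \<le> \<rho> * f (set (take k G))"
      using k(2) rho_ge S(3) by (intro mult_left_mono) (auto simp: diff_divide_distrib)
    also have "\<dots> \<le> \<rho> * f (set (L @ take k G))"
      using LG set_take_subset[of k G] rho_ge by (intro mult_left_mono value_mono) auto
    finally have "opt C' \<le> \<rho> * f (set (L @ take k G))" .
    moreover have "sum_list (map w (take k G)) = sum w (set (take k G))"
      using G(1) by (simp add: sum.distinct_set_conv_list)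
    ultimately show ?thesis using k(1) unfolding serves_def
      by (intro exI[of _ "length L + k"]) (simp add: W_def)
  qed
  from next_capacity[of "\<rho> * opt C" "3 * C"] show ?case
  proof
    assume "\<forall>S\<subseteq>E. f S \<le> \<rho> * opt C"
    then show ?thesis
      using finish[OF LG, of S] S(3) G(2) below wLG by auto
  next
    assume "\<exists>D\<ge>3 * C. \<rho> * opt C < opt D \<and>
      (\<forall>C'. 0 \<le> C' \<longrightarrow> 3 * C \<le> C' \<longrightarrow> C' < D \<longrightarrow> opt C' \<le> \<rho> * opt C)"
    then obtain D where D: "3 * C \<le> D" "\<rho> * opt C < opt D"
      "\<And>C'. 0 \<le> C' \<Longrightarrow> 3 * C \<le> C' \<Longrightarrow> C' < D \<Longrightarrow> opt C' \<le> \<rho> * opt C"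
      by auto
    have serve: "serves \<rho> (L @ G) C'" if C': "0 < C'" "C' < D" for C'
    proof (cases "C' < W + C")
      case False
      have "opt C' \<le> \<rho> * opt C"
      proof (cases "C' < 3 * C")
        case True
        have "opt C' \<le> C' / C * (opt C + M)"
          using False W less.prems(3) M_ge by (intro opt_growth) auto
        also have "\<dots> \<le> 3 * (opt C + M)"
          using True less.prems(3) M_ge opt_nonneg[of C]
          by (intro mult_right_mono) (auto simp: field_simps)
        also have "\<dots> \<le> \<rho> * opt C" using less.prems(4) by (rule triple_capacity_arith)
        finally show ?thesis .
      qed (use D(3) C' in auto)
      then show ?thesis
        using False wLG LG rho_ge G(2) S(3) by (intro serves_whole[of _ _ S]) auto
    qed (use below C' in auto)
    have optC: "opt C \<ge> 1"
    proof -
      have "1 \<le> \<rho>\<^sup>2" using rho_ge by (intro one_le_power) simp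
      then show ?thesis using less.prems(4) by simp
    qed
    then have "2 * opt C \<le> \<rho> * opt C" using rho_ge by (intro mult_right_mono) auto
    then have grow: "opt D \<ge> opt C + 1" using D(2) optC by linarith
    show ?thesis
    proof (cases n)
      case 0
      have "opt D \<le> f E" using D(1) less.prems(3) by (intro opt_le value_mono) auto
      then show ?thesis using 0 less.prems(6) grow by simp
    next
      case (Suc m)
      have "f E \<le> opt D + real m" using less.prems(6) grow Suc by simp
      moreover have "\<rho>\<^sup>2 \<le> opt D" using grow less.prems(4) by simp
      moreover have "sum_list (map w (L @ G)) \<le> 8 / 15 * D" using wLG W D(1) by linarith
      moreover have "0 < D" using D(1) less.prems(3) by linarith
      ultimately show ?thesis using less.IH[of m "L @ G" D] Suc LG serve by auto
    qed
  qed
qed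

lemma serving_list: "\<exists>L. set L = E \<and> (\<forall>C>0. serves \<rho> L C)"
proof (cases "E = {}")
  case True
  then have "serves \<rho> [] C" if "C > 0" for C
    using that opt_le[of C 0] value_empty unfolding serves_def by auto
  then show ?thesis using True by (intro exI[of _ "[]"]) auto
next
  case False
  define C1 where "C1 = Min (w ` E)"
  have C1: "C1 \<le> w e" if "e \<in> E" for e
    using that finite_ground by (auto simp: C1_def)
  have "C1 \<in> w ` E" using False finite_ground by (auto simp: C1_def)
  then obtain e1 where e1: "e1 \<in> E" "w e1 = C1" by auto
  have C1_nonneg: "C1 \<ge> 0" using weight_nonneg e1 by auto
  define F1 where "F1 = opt C1"
  have F1: "F1 \<ge> 1"
    using opt_ge[of "{e1}" C1] singleton_ge[OF e1(1)] e1 by (simp add: F1_def)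
  obtain S1 where S1: "S1 \<subseteq> E" "sum w S1 \<le> C1" "f S1 = F1"
    using opt_value_attained[OF finite_ground C1_nonneg] by (metis F1_def)
  obtain L1 where L1: "distinct L1" "set L1 = S1"
    using finite_distinct_list finite_sub[OF S1(1)] by blast
  have wL1: "sum_list (map w L1) \<le> C1"
    using S1(2) L1 by (metis sum.distinct_set_conv_list)
  have card_bound: "card S * C1 \<le> sum w S" if "S \<subseteq> E" for S
    using sum_bounded_below[of S C1 w] C1 that by auto
  \<comment> \<open>Below the least weight only the empty set fits, so the empty prefix
    suffices.\<close>
  have serve1: "serves \<rho> L1 C" if C: "0 < C" "C \<ge> C1 \<Longrightarrow> opt C \<le> \<rho> * F1" for C
  proof (cases "C < C1")
    case True
    have "f S \<le> 0" if S: "S \<subseteq> E" "sum w S \<le> C" for S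
    proof -
      have "card S * C1 < 1 * C1" using card_bound[OF S(1)] S(2) True by simp
      then have "card S = 0" using True C(1) by (simp add: mult_less_cancel_right)
      then show ?thesis using finite_sub[OF S(1)] value_empty by simp
    qed
    then have "opt C \<le> 0" using C by (intro opt_le) auto
    then show ?thesis using C unfolding serves_def by (intro exI[of _ 0]) (simp add: value_empty)
  next
    case False
    then show ?thesis using C wL1 L1 S1 rho_ge by (intro serves_whole[of _ _ S1]) auto
  qed
  have L1_sub: "set L1 \<subseteq> E" using L1 S1 by auto
  from next_capacity[of "\<rho> * F1" "3 * C1"] show ?thesis
  proof
    assume *: "\<forall>S\<subseteq>E. f S \<le> \<rho> * F1"
    have "opt C \<le> \<rho> * F1" if "C > 0" for C using * that by (intro opt_le) auto
    then show ?thesis using * finish[OF L1_sub, of S1] L1 S1 serve1 by auto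
  next
    assume "\<exists>C\<ge>3 * C1. \<rho> * F1 < opt C \<and>
      (\<forall>C'. 0 \<le> C' \<longrightarrow> 3 * C1 \<le> C' \<longrightarrow> C' < C \<longrightarrow> opt C' \<le> \<rho> * F1)"
    then obtain C2 where C2: "3 * C1 \<le> C2" "\<rho> * F1 < opt C2"
      "\<And>C. 0 \<le> C \<Longrightarrow> 3 * C1 \<le> C \<Longrightarrow> C < C2 \<Longrightarrow> opt C \<le> \<rho> * F1"
      by auto
    have rhoF1: "\<rho> \<le> \<rho> * F1" using mult_left_mono[OF F1, of \<rho>] rho_ge by simp
    \<comment> \<open>Zero weights allow \<open>C1 = 0\<close>, but the later quotients need
      \<open>C2 > 0\<close>.\<close>
    have "C2 \<noteq> 0"
    proof
      assume "C2 = 0"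
      then have "opt C2 = F1" using C2(1) C1_nonneg by (simp add: F1_def)
      then show False using C2(2) F1 rho_ge mult_right_mono[of 1 \<rho> F1] by simp
    qed
    then have C2_pos: "C2 > 0" using C2(1) C1_nonneg by simp
    have upto_C2: "opt C \<le> \<rho> * F1" if C: "0 \<le> C" "C < C2" for C
    proof (cases "C < 3 * C1")
      case True
      \<comment> \<open>Fewer than three elements fit below \<open>3 * C1\<close>, and two are worth
        at most \<open>2 * M \<le> \<rho>\<close>.\<close>
      have "f S \<le> \<rho>" if S: "S \<subseteq> E" "sum w S \<le> C" for S
      proof -
        have "card S * C1 < 3 * C1" using card_bound[OF S(1)] S(2) True by simp
        then have "card S \<le> 2" using True C(1) by (simp add: mult_less_cancel_right)
        then have "card S * M \<le> 2 * M" using M_ge by (intro mult_right_mono) auto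
        then show ?thesis using value_le_card[OF S(1)] rho_M by simp
      qed
      then have "opt C \<le> \<rho>" using C by (intro opt_le) auto
      then show ?thesis using rhoF1 by simp
    qed (use C2(3) C in auto)
    obtain S2 where S2: "S2 \<subseteq> E" "sum w S2 \<le> C2" "f S2 = opt C2"
      using opt_value_attained[OF finite_ground, of C2] C2_pos by (metis less_imp_le)
    have F2: "f S2 > \<rho> * F1" using C2(2) S2(3) by simp
    then have "S2 \<noteq> {}" using value_empty rhoF1 rho_ge by fastforce
    then obtain e2 where e2: "e2 \<in> S2" by auto
    obtain L2 where L2: "distinct L2" "set L2 = S2 - {e2}"
      using finite_distinct_list[of "S2 - {e2}"] finite_sub[OF S2(1)] by auto
    \<comment> \<open>\<open>e2\<close> comes last: leaving it out frees at least \<open>C1\<close>,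
      which pays for \<open>L1\<close>, so \<open>L1 @ L2\<close> already fits into capacity
      \<open>C2\<close>.\<close>
    define L where "L = L1 @ L2 @ [e2]"
    have set_L: "set L = S1 \<union> S2" using L1 L2 e2 by (auto simp: L_def)
    have sumS2: "sum w S2 = w e2 + sum w (S2 - {e2})"
      using e2 finite_sub[OF S2(1)] by (simp add: sum.remove)
    have wL2: "sum_list (map w L2) = sum w (S2 - {e2})"
      using L2 by (metis sum.distinct_set_conv_list)
    have wL: "sum_list (map w L) \<le> C1 + C2"
      using wL1 wL2 S2(2) sumS2 by (simp add: L_def)
    have L_sub: "set L \<subseteq> E" using set_L S1 S2 by auto
    have below: "serves \<rho> L C" if C: "0 < C" "C < C1 + C2" for C
    proof (cases "C < C2")
      case True
      then show ?thesis unfolding L_def using C upto_C2 by (intro serves_append serve1) auto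
    next
      case False
      \<comment> \<open>Dropping any element frees at least \<open>C1\<close> and leaves a weight
        below \<open>C2\<close>, where \<open>upto_C2\<close> applies.\<close>
      have "opt C \<le> \<rho> * F1 + M"
      proof (rule opt_le)
        fix S assume S: "S \<subseteq> E" "sum w S \<le> C"
        show "f S \<le> \<rho> * F1 + M"
        proof (cases "S = {}")
          case True
          then show ?thesis using value_empty rhoF1 rho_ge M_ge by simp
        next
          case False
          then obtain e where e: "e \<in> S" by auto
          have "w e + sum w (S - {e}) \<le> C"
            using S e finite_sub[OF S(1)] by (simp add: sum.remove)
          then have le: "sum w (S - {e}) \<le> C - C1" using C1[of e] e S(1) by auto
          have "0 \<le> sum w (S - {e})" using S(1) by (intro sum_weight_nonneg) auto
          then have "f (S - {e}) \<le> \<rho> * F1"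
            using le C S(1) upto_C2[of "C - C1"] opt_ge[of "S - {e}" "C - C1"] by force
          then show ?thesis using value_remove_le[OF S(1) e] by simp
        qed
      qed (use C in auto)
      also have "\<dots> \<le> \<rho> * (\<rho> * F1 - M)" using F1 by (rule second_phase_arith)
      also have "\<dots> \<le> \<rho> * f (S2 - {e2})"
        using value_remove_le[OF S2(1) e2] F2 rho_ge by (intro mult_left_mono) auto
      finally have *: "opt C \<le> \<rho> * f (S2 - {e2})" .
      have "w e2 \<ge> C1" using C1 e2 S2(1) by auto
      then have "sum_list (map w (L1 @ L2)) \<le> C"
        using wL1 wL2 sumS2 S2(2) False by simp
      then have "serves \<rho> (L1 @ L2) C"
        using * L2 L1_sub S2(1) rho_ge by (intro serves_whole[of _ _ "S2 - {e2}"]) auto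
      then show ?thesis using serves_append[of \<rho> "L1 @ L2" C "[e2]"] by (simp add: L_def)
    qed
    from next_capacity[of "\<rho> * opt C2" "5 / 2 * C2"] show ?thesis
    proof
      assume "\<forall>S\<subseteq>E. f S \<le> \<rho> * opt C2"
      then show ?thesis
        using finish[OF L_sub, of S2] S2(3) set_L below wL by auto
    next
      assume "\<exists>C\<ge>5 / 2 * C2. \<rho> * opt C2 < opt C \<and>
        (\<forall>C'. 0 \<le> C' \<longrightarrow> 5 / 2 * C2 \<le> C' \<longrightarrow> C' < C \<longrightarrow> opt C' \<le> \<rho> * opt C2)"
      then obtain C3 where C3: "5 / 2 * C2 \<le> C3" "\<rho> * opt C2 < opt C3"
        "\<And>C. 0 \<le> C \<Longrightarrow> 5 / 2 * C2 \<le> C \<Longrightarrow> C < C3 \<Longrightarrow> opt C \<le> \<rho> * opt C2"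
        by auto
      have optC2: "opt C2 \<ge> \<rho>" using C2(2) rhoF1 by simp
      have serve: "serves \<rho> L C" if C: "0 < C" "C < C3" for C
      proof (cases "C < C1 + C2")
        case False
        have "opt C \<le> \<rho> * opt C2"
        proof (cases "C < 5 / 2 * C2")
          case True
          have "opt C \<le> C / C2 * (opt C2 + M)"
            using False C1_nonneg C2_pos M_ge by (intro opt_growth) auto
          also have "\<dots> \<le> 5 / 2 * (opt C2 + M)"
            using True C2_pos M_ge optC2 rho_ge by (intro mult_right_mono) (auto simp: field_simps)
          also have "\<dots> \<le> \<rho> * opt C2" using optC2 by (rule second_capacity_arith)
          finally show ?thesis .
        qed (use C3(3) C in auto)
        then show ?thesis
          using False wL L_sub rho_ge set_L S2(3) by (intro serves_whole[of _ _ S2]) auto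
      qed (use below C in auto)
      have "\<rho>\<^sup>2 \<le> \<rho> * opt C2" using optC2 rho_ge by (simp add: power2_eq_square)
      then have "\<rho>\<^sup>2 \<le> opt C3" using C3(2) by simp
      moreover obtain n where "f E - opt C3 \<le> real n" using real_arch_simple by blast
      moreover have "sum_list (map w L) \<le> 8 / 15 * C3" using wL C2(1) C3(1) by linarith
      moreover have "0 < C3" using C3(1) C2_pos by linarith
      ultimately show ?thesis using late_phases[of L C3 n] L_sub serve by auto
    qed
  qed
qed

end

theorem competitive_exists:
  assumes "M \<ge> 1" "knapsack_instance M E w f"
  shows "\<exists>\<pi>\<in>permutations_of_set E. competitive (max (3.293 * sqrt M) (2 * M)) E w f \<pi>"
proof -
  define \<rho> where "\<rho> = max (3.293 * sqrt M) (2 * M)"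
  have sqrt: "sqrt M \<ge> 1" using assms(1) by simp
  \<comment> \<open>\<open>3.293\<close> squared is \<open>10.843849\<close>.\<close>
  have "10.84 * M \<le> (3.293 * sqrt M)\<^sup>2"
    using assms(1) by (simp add: power_mult_distrib power2_eq_square)
  also have "\<dots> \<le> \<rho>\<^sup>2"
    unfolding \<rho>_def using sqrt by (intro power_mono) auto
  finally have "10.84 * M \<le> \<rho>\<^sup>2" .
  moreover have "3.293 \<le> \<rho>" unfolding \<rho>_def using sqrt by (intro max.coboundedI1) simp
  moreover have "2 * M \<le> \<rho>" by (simp add: \<rho>_def)
  ultimately interpret knapsack_ratio M E w f \<rho>
    by unfold_locales (use assms in auto)
  show ?thesis
    using serving_list competitive_of_serves rho_ge unfolding \<rho>_def[symmetric] by fastforce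
qed

section \<open>Lower bounds\<close>

lemma fitting_prefix_mono:
  assumes "\<pi> \<in> permutations_of_set E" "0 \<le> C" "C \<le> D"
  shows "fitting_prefix w \<pi> C \<subseteq> fitting_prefix w \<pi> D"
proof -
  obtain k where k: "fitting_prefix w \<pi> C = set (take k \<pi>)" "sum w (set (take k \<pi>)) \<le> C"
    using fitting_prefix_eq[OF assms(1,2)] by metis
  obtain j where "fitting_prefix w \<pi> D = set (take j \<pi>)"
    "\<And>k'. sum w (set (take k' \<pi>)) \<le> D \<Longrightarrow> set (take k' \<pi>) \<subseteq> set (take j \<pi>)"
    using fitting_prefix_eq[OF assms(1), of D] assms(2,3) by (metis order.trans)
  with k assms(3) show ?thesis by auto
qed

lemma fitting_prefix_weight:
  assumes "\<pi> \<in> permutations_of_set E" "0 \<le> C"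
  shows "fitting_prefix w \<pi> C \<subseteq> E" "sum w (fitting_prefix w \<pi> C) \<le> C"
proof -
  obtain k where k: "fitting_prefix w \<pi> C = set (take k \<pi>)" "sum w (set (take k \<pi>)) \<le> C"
    using fitting_prefix_eq[OF assms] by metis
  then show "fitting_prefix w \<pi> C \<subseteq> E" "sum w (fitting_prefix w \<pi> C) \<le> C"
    using set_take_subset[of k \<pi>] assms(1) by (auto simp: permutations_of_set_def)
qed

lemma competitive_value:
  assumes "competitive \<rho> E w f \<pi>" "finite E" "S \<subseteq> E" "sum w S \<le> C" "0 < C"
  shows "f S \<le> \<rho> * f (fitting_prefix w \<pi> C)"
  using assms opt_value_ge[of E S w C f] unfolding competitive_def by force

text \<open>A cheap element of value 1, which any competitive order has to take first, against a slightly
  heavier one of value \<open>M\<close>.\<close>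

lemma ratio_M_necessary:
  assumes "M \<ge> 1"
  shows "\<exists>(E :: nat set) w f. knapsack_instance M E w f \<and>
    (\<forall>\<rho> < M. \<not> (\<exists>\<pi>\<in>permutations_of_set E. competitive \<rho> E w f \<pi>))"
proof -
  define E :: "nat set" where "E = {0, 1}"
  define w :: "nat \<Rightarrow> real" where "w = (\<lambda>e. if e = 0 then 1 else 2)"
  define v :: "nat \<Rightarrow> real" where "v = (\<lambda>e. if e = 0 then 1 else M)"
  have v_nonneg: "v e \<ge> 0" for e using assms by (simp add: v_def)
  have fin: "finite A" if "A \<subseteq> E" for A using that by (rule finite_subset) (simp add: E_def)
  have "fractionally_subadditive E (sum v)"
    using fin v_nonneg by (intro fractionally_subadditiveI exI[of _ v]) auto
  moreover have "mono_on (Pow E) (sum v)"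
    using fin v_nonneg by (auto simp: mono_on_def intro!: sum_mono2)
  ultimately have inst: "knapsack_instance M E w (sum v)"
    using assms v_nonneg by (auto simp: knapsack_instance_def E_def w_def v_def bounded_by_def sum_nonneg)
  have "\<not> competitive \<rho> E w (sum v) \<pi>" if "\<rho> < M" and \<pi>: "\<pi> \<in> permutations_of_set E" for \<rho> \<pi>
  proof
    assume comp: "competitive \<rho> E w (sum v) \<pi>"
    let ?P = "fitting_prefix w \<pi>"
    have P: "?P C \<subseteq> E" "sum w (?P C) \<le> C" if "C \<ge> 0" for C
      using fitting_prefix_weight[OF \<pi> that] by auto
    have no1: "1 \<notin> A" if "A \<subseteq> E" "sum w A < 2" for A
    proof
      assume "1 \<in> A"
      then have "w 1 \<le> sum w A"
        using fin[OF that(1)] by (intro member_le_sum) (auto simp: w_def)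
      then show False using that(2) by (simp add: w_def)
    qed
    \<comment> \<open>The empty set is worth 0, so capacity 1 forces a nonempty prefix, and only the
      element 0 fits.\<close>
    have "1 \<le> \<rho> * sum v (?P 1)"
      using competitive_value[OF comp, of "{0}" 1] by (simp add: E_def w_def v_def)
    then have "?P 1 \<noteq> {}" by auto
    moreover have "1 \<notin> ?P 1" using no1[of "?P 1"] P[of 1] by auto
    ultimately have "0 \<in> ?P 1" using P(1)[of 1] by (auto simp: E_def)
    then have "0 \<in> ?P 2" using fitting_prefix_mono[OF \<pi>, of 1 2] by auto
    have "1 \<notin> ?P 2"
    proof
      assume "1 \<in> ?P 2"
      with \<open>0 \<in> ?P 2\<close> have "?P 2 = {0, 1}" using P(1)[of 2] by (auto simp: E_def)
      then show False using P(2)[of 2] by (simp add: w_def)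
    qed
    with \<open>0 \<in> ?P 2\<close> have "?P 2 = {0}" using P(1)[of 2] by (auto simp: E_def)
    then have "M \<le> \<rho>"
      using competitive_value[OF comp, of "{1}" 2] by (simp add: E_def w_def v_def)
    then show False using \<open>\<rho> < M\<close> by simp
  qed
  with inst show ?thesis by blast
qed

text \<open>Ten elements in three groups of sizes 1, 3 and 6 whose values do not add up across groups. The
  groups are worth 1, about \<open>sqrt 6\<close> and 6. The weights 9, 10 and 11 force an order to start with the
  first group, and then to take all of the second group before it can collect three elements of the
  third one; so at capacity 66 it only has value \<open>sqrt 6\<close>.\<close>

definition gap_weight :: "nat \<Rightarrow> real" where
  "gap_weight e = 9 * indicator {0} e + 10 * indicator {1..3} e + 11 * indicator {4..9} e"

definition gap_value :: "real \<Rightarrow> nat set \<Rightarrow> real" where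
  "gap_value d S = (if S = {} then 0 else
     max 1 (max (d * card (S \<inter> {1..3})) (card (S \<inter> {4..9}))))"

lemma sum_indicator_real: "finite S \<Longrightarrow> sum (indicator T) S = real (card (S \<inter> T))"
  by (induction S rule: finite_induct) (auto simp: indicator_def Int_insert_left)

lemma sum_gap_weight:
  assumes "finite S"
  shows "sum gap_weight S =
    real (9 * card (S \<inter> {0}) + 10 * card (S \<inter> {1..3}) + 11 * card (S \<inter> {4..9}))"
  using assms by (simp add: gap_weight_def sum.distrib sum_distrib_left[symmetric] sum_indicator_real)

lemma gap_value_ge:
  fixes d :: real
  shows
  "d * card (S \<inter> {1..3}) \<le> gap_value d S" "card (S \<inter> {4..9}) \<le> gap_value d S"
  "S \<noteq> {} \<Longrightarrow> 1 \<le> gap_value d S"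
  by (auto simp: gap_value_def)

lemma gap_value_cases:
  fixes d :: real
  assumes "S \<noteq> {}"
  shows "gap_value d S = 1 \<or> gap_value d S = d * card (S \<inter> {1..3}) \<or>
    gap_value d S = card (S \<inter> {4..9})"
proof -
  have "max a (max b c) = a \<or> max a (max b c) = b \<or> max a (max b c) = c" for a b c :: real
    by (auto simp: max_def)
  then show ?thesis using assms by (simp add: gap_value_def)
qed

text \<open>On subsets of the ground set \<open>gap_value d\<close> is a maximum of additive
  functions: one for each single element, one for the second group and one for the third. A function
  attaining the maximum at \<open>A\<close> is the required minorant. \<open>d \<le> 1\<close> keeps
  all singletons at value 1.\<close>

lemma gap_instance:
  assumes "M \<ge> 1" "0 \<le> d" "d \<le> 1"
  shows "knapsack_instance M {0..9} gap_weight (gap_value d)"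
proof -
  have fin: "finite A" if "A \<subseteq> {0..9}" for A :: "nat set"
    using that by (rule finite_subset) simp
  have "\<exists>v. (\<forall>e\<in>{0..9}. v e \<ge> 0) \<and> gap_value d A \<le> sum v A \<and>
      (\<forall>B\<subseteq>{0..9}. sum v B \<le> gap_value d B)"
    if A: "A \<subseteq> {0..9}" for A
  proof -
    have ind: "sum (\<lambda>x. c * indicator T x) B = c * card (B \<inter> T)"
      if "B \<subseteq> {0..9}" for B T :: "nat set" and c :: real
      using fin[OF that] by (simp add: sum_indicator_real flip: sum_distrib_left)
    have supp: "\<exists>v. (\<forall>e\<in>{0..9}. v e \<ge> 0) \<and> gap_value d A \<le> sum v A \<and>
        (\<forall>B\<subseteq>{0..9}. sum v B \<le> gap_value d B)"
      if "0 \<le> c" "gap_value d A \<le> c * real (card (A \<inter> T))"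
        "\<And>B. B \<subseteq> {0..9} \<Longrightarrow> c * real (card (B \<inter> T)) \<le> gap_value d B" for c T
      using that A by (intro exI[of _ "\<lambda>x. c * indicator T x"]) (simp add: ind)
    consider "A = {}" | e where "e \<in> A" "gap_value d A = 1"
      | "gap_value d A = d * card (A \<inter> {1..3})" | "gap_value d A = card (A \<inter> {4..9})"
      using gap_value_cases[of A d] by auto
    then show ?thesis
    proof cases
      case 1
      then show ?thesis using gap_value_ge by (intro supp[of 0 "{}"]) (auto simp: gap_value_def)
    next
      case 2
      have "card (B \<inter> {e}) \<le> gap_value d B" for B
        using gap_value_ge(3)[of B d] by (cases "e \<in> B") (auto simp: gap_value_def)
      then show ?thesis using 2 by (intro supp[of 1 "{e}"]) auto
    next
      case 3
      then show ?thesis using assms(2) gap_value_ge(1) by (intro supp[of d "{1..3}"]) auto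
    next
      case 4
      then show ?thesis using gap_value_ge(2) by (intro supp[of 1 "{4..9}"]) auto
    qed
  qed
  then have "fractionally_subadditive {0..9} (gap_value d)"
    by (intro fractionally_subadditiveI) auto
  moreover have "mono_on (Pow {0..9}) (gap_value d)"
  proof (rule mono_onI)
    fix A B :: "nat set" assume *: "A \<in> Pow {0..9}" "B \<in> Pow {0..9}" "A \<subseteq> B"
    have "card (A \<inter> X) \<le> card (B \<inter> X)" for X
      using * fin by (intro card_mono) auto
    then have "max 1 (max (d * card (A \<inter> {1..3})) (card (A \<inter> {4..9})))
        \<le> max 1 (max (d * card (B \<inter> {1..3})) (card (B \<inter> {4..9})) :: real)"
      using assms(2) by (intro max.mono mult_left_mono) simp_all
    then show "gap_value d A \<le> gap_value d B"
      unfolding gap_value_def using *(3) by auto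
  qed
  moreover have "gap_value d {e} = 1" for e
    using assms(2,3) by (simp add: gap_value_def Int_insert_left)
  moreover have "gap_value d S \<ge> 0" for S
    using gap_value_ge(3)[of S d] by (cases "S = {}") (auto simp: gap_value_def)
  ultimately show ?thesis using assms(1)
    by (auto simp: knapsack_instance_def bounded_by_def gap_weight_def)
qed

text \<open>The capacities 9, 30, 55 and 66 are the weights of the first group, the second group,
  five elements of the third and all six. The final contradiction is
  \<open>2.449 * 2.449 < 6\<close>.\<close>

lemma gap_ratio:
  assumes "\<rho> < 2.449" and \<pi>: "\<pi> \<in> permutations_of_set {0..9}" and d: "3 * d = 2.449"
  shows "\<not> competitive \<rho> {0..9} gap_weight (gap_value d) \<pi>"
proof
  assume comp: "competitive \<rho> {0..9} gap_weight (gap_value d) \<pi>"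
  let ?P = "fitting_prefix gap_weight \<pi>"
  define x where "x C = card (?P C \<inter> {0})" for C
  define y where "y C = card (?P C \<inter> {1..3})" for C
  define z where "z C = card (?P C \<inter> {4..9})" for C
  \<comment> \<open>\<open>m\<close> omits the empty case of \<open>gap_value\<close>, which
    competitiveness rules out.\<close>
  define m where "m C = max 1 (max (d * y C) (z C))" for C
  have d01: "0 \<le> d" "d \<le> 1" using d by simp_all
  have P: "?P C \<subseteq> {0..9}" "sum gap_weight (?P C) \<le> C" if "C \<ge> 0" for C
    using fitting_prefix_weight[OF \<pi> that] by auto
  have finP: "finite (?P C)" if "C \<ge> 0" for C
    using P(1)[OF that] by (rule finite_subset) simp
  have weight: "9 * x (real n) + 10 * y (real n) + 11 * z (real n) \<le> n" for n
    using P(2)[of "real n"] sum_gap_weight[OF finP[of "real n"]]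
    unfolding x_def y_def z_def by (simp only: of_nat_le_iff of_nat_0_le_iff)
  have mono: "x C \<le> x D" "y C \<le> y D" if "0 \<le> C" "C \<le> D" for C D
    using fitting_prefix_mono[OF \<pi> that] finP[of D] that
    unfolding x_def y_def by (auto intro!: card_mono)
  have y_le: "y C \<le> 3" for C
    using card_mono[of "{1..3}" "?P C \<inter> {1..3}"] by (simp add: y_def)
  have lower: "a < 2.449 * m C"
    if "S \<subseteq> {0..9}" "sum gap_weight S \<le> C" "0 < C" "0 < a" "a \<le> gap_value d S" for S C a
  proof -
    have le: "a \<le> \<rho> * gap_value d (?P C)"
      using competitive_value[OF comp _ that(1-3)] that(5) by simp
    then have "?P C \<noteq> {}" using that(4) by (auto simp: gap_value_def)
    then have eq: "gap_value d (?P C) = m C"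
      by (simp add: gap_value_def y_def z_def m_def)
    moreover have "m C > 0" by (simp add: m_def)
    ultimately show ?thesis
      using le mult_strict_right_mono[OF assms(1)] by (metis order.strict_trans1)
  qed
  have "1 \<le> \<rho> * gap_value d (?P 9)"
    using competitive_value[OF comp, of "{0}" 9] by (simp add: gap_value_def gap_weight_def)
  then have "?P 9 \<noteq> {}" by (auto simp: gap_value_def)
  then obtain e where "e \<in> ?P 9" by auto
  then have pos: "card (?P 9 \<inter> T) > 0" if "e \<in> T" for T
    using that finP[of 9] by (subst card_gt_0_iff) auto
  have "e \<in> {0} \<or> e \<in> {1..3} \<or> e \<in> {4..9}" using P(1)[of 9] \<open>e \<in> ?P 9\<close> by force
  then have "x 9 > 0 \<or> y 9 > 0 \<or> z 9 > 0"
    using pos[of "{0}"] pos[of "{1..3}"] pos[of "{4..9}"] unfolding x_def y_def z_def by argo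
  then have "x 9 \<ge> 1" using weight[of 9] by simp
  then have x: "x C \<ge> 1" if "C \<ge> 9" for C using mono(1)[of 9 C] that by simp
  have "2.449 < 2.449 * m 30"
    using lower[of "{1..3}" 30 "2.449"] gap_value_ge(1)[of d "{1..3}"] d
    by (simp add: sum_gap_weight mult.commute[of d])
  then have m30: "m 30 > 1" by simp
  \<comment> \<open>Next to element 0 at most one element of the third group fits; together with at
    most one of the second group the value is only 1.\<close>
  have "y 30 \<ge> 2"
  proof (rule ccontr)
    assume "\<not> y 30 \<ge> 2"
    moreover have "9 + 10 * y 30 + 11 * z 30 \<le> 30" using weight[of 30] x[of 30] by simp
    ultimately have "y 30 \<le> 1" "z 30 \<le> 1" by linarith+
    moreover from this have "d * y 30 \<le> 1" using d01 by (intro mult_le_one) auto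
    ultimately show False using m30 by (simp add: m_def)
  qed
  then have y55: "y 55 \<ge> 2" using mono(2)[of 30 55] by simp
  have "5 < 2.449 * m 55"
    by (intro lower[of "{4..8}"] order.trans[OF _ gap_value_ge(2)]) (auto simp: sum_gap_weight Int_absorb2)
  then have m55: "m 55 > 2" by simp
  \<comment> \<open>With only two elements of the second group, at most two of the third fit, so the
    value is at most 2, less than the required \<open>5 / 2.449\<close>.\<close>
  have "y 55 \<ge> 3"
  proof (rule ccontr)
    assume "\<not> y 55 \<ge> 3"
    moreover have "9 + 10 * y 55 + 11 * z 55 \<le> 55" using weight[of 55] x[of 55] by simp
    ultimately have "y 55 \<le> 2" "z 55 \<le> 2" using y55 by linarith+
    moreover from this have "d * y 55 \<le> 1 * 2" using d01 by (intro mult_mono) auto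
    ultimately show False using m55 by (simp add: m_def)
  qed
  then have y66: "y 66 = 3" using mono(2)[of 55 66] y_le[of 66] by simp
  have "9 + 10 * y 66 + 11 * z 66 \<le> 66" using weight[of 66] x[of 66] by simp
  then have "z 66 \<le> 2" using y66 by linarith
  then have "m 66 \<le> 2.449" using y66 d by (simp add: m_def)
  moreover have "6 < 2.449 * m 66"
    by (intro lower[of "{4..9}"] order.trans[OF _ gap_value_ge(2)]) (auto simp: sum_gap_weight)
  ultimately show False by simp
qed

lemma ratio_necessary:
  assumes "M \<ge> 1" "\<rho> < max 2.449 M"
  shows "\<exists>(E :: nat set) w f. knapsack_instance M E w f \<and>
    \<not> (\<exists>\<pi>\<in>permutations_of_set E. competitive \<rho> E w f \<pi>)"
proof (cases "\<rho> < M")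
  case True
  then show ?thesis using ratio_M_necessary[OF assms(1)] by blast
next
  case False
  then have "\<rho> < 2.449" using assms(2) by simp
  then show ?thesis using gap_instance[OF assms(1), of "2.449 / 3"] gap_ratio[of \<rho> _ "2.449 / 3"]
    by (intro exI[of _ "{0..9}"] exI[of _ gap_weight] exI[of _ "gap_value (2.449 / 3)"]) auto
qed

theorem theorem1:
  fixes M :: real
  assumes "M \<ge> 1"
  shows "(\<forall>(E :: 'a set) w f. knapsack_instance M E w f \<longrightarrow>
            (\<exists>\<pi>\<in>permutations_of_set E.
               competitive (max (3.293 * sqrt M) (2 * M)) E w f \<pi>))
       \<and> (\<forall>\<rho> < max 2.449 M.
            \<exists>(E :: nat set) w f. knapsack_instance M E w f \<and>
              \<not> (\<exists>\<pi>\<in>permutations_of_set E. competitive \<rho> E w f \<pi>))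
       \<and> best_competitive_ratio M \<in> {max 2.449 M .. max (3.293 * sqrt M) (2 * M)}"
proof (intro conjI)
  show "\<forall>(E :: 'a set) w f. knapsack_instance M E w f \<longrightarrow>
      (\<exists>\<pi>\<in>permutations_of_set E. competitive (max (3.293 * sqrt M) (2 * M)) E w f \<pi>)"
    using competitive_exists[OF assms] by blast
  show "\<forall>\<rho> < max 2.449 M. \<exists>(E :: nat set) w f. knapsack_instance M E w f \<and>
      \<not> (\<exists>\<pi>\<in>permutations_of_set E. competitive \<rho> E w f \<pi>)"
    using ratio_necessary[OF assms] by blast
  let ?R = "{\<rho>. \<rho> \<ge> 1 \<and> (\<forall>(E :: nat set) w f. knapsack_instance M E w f \<longrightarrow>
    (\<exists>\<pi>\<in>permutations_of_set E. competitive \<rho> E w f \<pi>))}"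
  have upper: "max (3.293 * sqrt M) (2 * M) \<in> ?R"
    using competitive_exists[OF assms] assms by auto
  have lower: "max 2.449 M \<le> \<rho>" if "\<rho> \<in> ?R" for \<rho>
  proof (rule ccontr)
    assume "\<not> max 2.449 M \<le> \<rho>"
    then have "\<rho> < max 2.449 M" by (simp only: not_le)
    from ratio_necessary[OF assms this] obtain E :: "nat set" and w f
      where "knapsack_instance M E w f" "\<not> (\<exists>\<pi>\<in>permutations_of_set E. competitive \<rho> E w f \<pi>)"
      by auto
    then show False using that by blast
  qed
  \<comment> \<open>For reals, \<open>Inf\<close> is a greatest lower bound only if the set is
    nonempty and bounded below; \<open>upper\<close> gives the member, \<open>lower\<close> the
    bound.\<close>
  have "bdd_below ?R" using lower by (rule bdd_belowI)
  then have "Inf ?R \<le> max (3.293 * sqrt M) (2 * M)" using upper by (intro cInf_lower)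
  moreover have "max 2.449 M \<le> Inf ?R" using upper lower by (intro cInf_greatest) blast+
  ultimately show "best_competitive_ratio M \<in> {max 2.449 M .. max (3.293 * sqrt M) (2 * M)}"
    unfolding best_competitive_ratio_def by (simp only: atLeastAtMost_iff simp_thms)
qed

end
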